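(* Let $\mathbb{F}$ be a field of characteristic $0$, let $n\ge 1$, and let $B$ be a nilpotent $n\times n$ matrix over $\mathbb{F}$ of shape $\operatorname{sh}(B)=(\mu_1,\mu_2,\ldots,\mu_t)$. Set $\mu_0=\mu_1+1$. Then $$\iota(\mathcal{N}_B)=\max\{\,2i+\mu_{i+1}+\mu_{i+2}+\cdots+\mu_{i+r}\;:\;0\le i<t,\ r\ge 1,\ i+r\le t,\ \mu_{i+1}-\mu_{i+r}\le 1,\ \mu_i\ne\mu_{i+1}\,\}.$$
   Context: For a nilpotent matrix $B$, the shape $\operatorname{sh}(B)=(\mu_1,\ldots,\mu_t)$, with $\mu_1\ge\mu_2\ge\cdots\ge\mu_t>0$, is the partition of $n$ formed by the sizes of the Jordan blocks in the Jordan canonical form of $B$. $\mathcal{N}_B$ denotes the set of all nilpotent $n\times n$ matrices $A$ over $\mathbb{F}$ with $AB=BA$. For a nilpotent matrix $A$, $\iota(A)=\min\{i\ge 1 : A^i=0\}$ is its index of nilpotency, and $\iota(\mathcal{N}_B)=\max\{\iota(A) : A\in\mathcal{N}_B\}$. *)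

theory Defs
  imports
    "Jordan_Normal_Form.Jordan_Normal_Form_Existence"
    "Jordan_Normal_Form.Jordan_Normal_Form_Uniqueness"
    "Jordan_Normal_Form.DL_Rank"
begin

definition nilpotent_mat :: "'a::semiring_1 mat \<Rightarrow> bool" where
  "nilpotent_mat A \<longleftrightarrow> square_mat A \<and> (\<exists>k. A ^\<^sub>m k = 0\<^sub>m (dim_row A) (dim_row A))"

definition nilpotency_index :: "'a::semiring_1 mat \<Rightarrow> nat" where
  "nilpotency_index A = (LEAST i. 1 \<le> i \<and> A ^\<^sub>m i = 0\<^sub>m (dim_row A) (dim_row A))"

definition nilpotent_commutator :: "'a::semiring_1 mat \<Rightarrow> 'a mat set" where
  "nilpotent_commutator B =
     {A \<in> carrier_mat (dim_row B) (dim_row B). nilpotent_mat A \<and> A * B = B * A}"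

text \<open>The chosen Jordan normal form is irrelevant (\<open>shape_eq\<close> below), and one exists for
  every nilpotent matrix over a field (\<open>nilpotent_jordan_nf\<close> below).\<close>

definition shape :: "'a::field mat \<Rightarrow> nat list" where
  "shape B = rev (sort (map fst (SOME n_as. jordan_nf B n_as)))"

text \<open>Parts are indexed from 1, with the convention that part 0 is one more than part 1.
  Only indices up to \<open>length \<mu>\<close> are meaningful.\<close>

definition part :: "nat list \<Rightarrow> nat \<Rightarrow> nat" where
  "part \<mu> i = (if i = 0 then \<mu> ! 0 + 1 else \<mu> ! (i - 1))"

lemma shape_eq:
  fixes B :: "'a::field mat"
  assumes "jordan_nf B n_as"
  shows "shape B = rev (sort (map fst n_as))"
proof -
  define m_bs where "m_bs = (SOME n_as. jordan_nf B n_as)"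
  have m: "jordan_nf B m_bs"
    unfolding m_bs_def using assms by (rule someI)
  have "count (mset m_bs) x = count (mset n_as) x" for x
  proof (cases x)
    case (Pair k ev)
    show ?thesis
    proof (cases "k = 0")
      case True
      then have "x \<notin> set m_bs" "x \<notin> set n_as"
        using m assms Pair unfolding jordan_nf_def by force+
      then have "count (mset m_bs) x = 0" "count (mset n_as) x = 0" by simp_all
      then show ?thesis by (rule trans[OF _ sym])
    next
      case False
      have "length (filter ((=) (k, ev)) m_bs) = length (filter ((=) (k, ev)) n_as)"
        using compute_nr_of_jordan_blocks[OF m False, of ev]
          compute_nr_of_jordan_blocks[OF assms False, of ev] by simp
      then show ?thesis by (simp add: Pair count_mset count_list_eq_length_filter)
    qed
  qed
  then have "mset m_bs = mset n_as" by (rule multiset_eqI)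
  then have "mset (map fst m_bs) = mset (map fst n_as)" by simp
  then have "sort (map fst m_bs) = sort (map fst n_as)"
    by (metis properties_for_sort mset_sort sorted_sort)
  then show ?thesis unfolding shape_def m_bs_def by simp
qed

lemma pow_four_block_lower_right:
  fixes A2 A3 :: "'a::semiring_1 mat"
  assumes A1: "A1 \<in> carrier_mat 1 1" and A2: "A2 \<in> carrier_mat 1 m"
    and A3: "A3 \<in> carrier_mat m m"
  shows "\<exists>X Y. X \<in> carrier_mat 1 1 \<and> Y \<in> carrier_mat 1 m \<and>
    four_block_mat A1 A2 (0\<^sub>m m 1) A3 ^\<^sub>m k = four_block_mat X Y (0\<^sub>m m 1) (A3 ^\<^sub>m k)"
proof (induction k)
  case 0
  have "four_block_mat A1 A2 (0\<^sub>m m 1) A3 ^\<^sub>m 0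
      = four_block_mat (1\<^sub>m 1) (0\<^sub>m 1 m) (0\<^sub>m m 1) (A3 ^\<^sub>m 0)"
  proof (rule eq_matI)
    fix i j
    assume "i < dim_row (four_block_mat (1\<^sub>m 1) (0\<^sub>m 1 m) (0\<^sub>m m 1) (A3 ^\<^sub>m 0))"
      and "j < dim_col (four_block_mat (1\<^sub>m 1) (0\<^sub>m 1 m) (0\<^sub>m m 1) (A3 ^\<^sub>m 0))"
    then have "i < 1 + m" "j < 1 + m" using A3 by simp_all
    then show "(four_block_mat A1 A2 (0\<^sub>m m 1) A3 ^\<^sub>m 0) $$ (i, j)
        = four_block_mat (1\<^sub>m 1) (0\<^sub>m 1 m) (0\<^sub>m m 1) (A3 ^\<^sub>m 0) $$ (i, j)"
      using A1 A3 by simp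
  qed (use A1 A3 in simp_all)
  then show ?case by (intro exI[of _ "1\<^sub>m 1"] exI[of _ "0\<^sub>m 1 m"]) simp
next
  case (Suc k)
  then obtain X Y where X: "X \<in> carrier_mat 1 1" and Y: "Y \<in> carrier_mat 1 m"
    and eq: "four_block_mat A1 A2 (0\<^sub>m m 1) A3 ^\<^sub>m k = four_block_mat X Y (0\<^sub>m m 1) (A3 ^\<^sub>m k)"
    by blast
  have P: "A3 ^\<^sub>m k \<in> carrier_mat m m" using A3 by simp
  have "four_block_mat A1 A2 (0\<^sub>m m 1) A3 ^\<^sub>m Suc k
      = four_block_mat (X * A1 + Y * 0\<^sub>m m 1) (X * A2 + Y * A3)
          (0\<^sub>m m 1 * A1 + A3 ^\<^sub>m k * 0\<^sub>m m 1) (0\<^sub>m m 1 * A2 + A3 ^\<^sub>m k * A3)"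
    unfolding pow_mat.simps eq
    by (rule mult_four_block_mat[OF X Y zero_carrier_mat P A1 A2 zero_carrier_mat A3])
  also have "0\<^sub>m m 1 * A1 + A3 ^\<^sub>m k * 0\<^sub>m m 1 = 0\<^sub>m m 1"
    unfolding right_mult_zero_mat[OF P] left_mult_zero_mat[OF A1] by simp
  also have "0\<^sub>m m 1 * A2 + A3 ^\<^sub>m k * A3 = A3 ^\<^sub>m Suc k"
    unfolding left_mult_zero_mat[OF A2]
    using left_add_zero_mat[OF mult_carrier_mat[OF P A3]] by simp
  finally have "four_block_mat A1 A2 (0\<^sub>m m 1) A3 ^\<^sub>m Suc k
      = four_block_mat (X * A1 + Y * 0\<^sub>m m 1) (X * A2 + Y * A3) (0\<^sub>m m 1) (A3 ^\<^sub>m Suc k)" .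
  moreover have "X * A1 + Y * 0\<^sub>m m 1 \<in> carrier_mat 1 1" "X * A2 + Y * A3 \<in> carrier_mat 1 m"
    using X Y A1 A2 A3 by auto
  ultimately show ?case by blast
qed

lemma nilpotent_similar_upper_triangular:
  fixes A :: "'a::field mat"
  assumes "A \<in> carrier_mat n n" and "A ^\<^sub>m k = 0\<^sub>m n n"
  shows "\<exists>U \<in> carrier_mat n n. upper_triangular U \<and> similar_mat A U"
  using assms
proof (induction n arbitrary: A)
  case 0
  then show ?case by (intro bexI[of _ A]) (auto intro: similar_mat_refl)
next
  case (Suc m)
  let ?n = "Suc m"
  note A = Suc.prems(1)
  have "det (A ^\<^sub>m k) = 0"
    using Suc.prems(2) by simp
  moreover have "det (A ^\<^sub>m k) = det A ^ k"
    using A by (induction k) (auto simp: det_mult[of _ ?n])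
  ultimately have "det A = 0" by simp
  then obtain v where v: "v \<in> carrier_vec ?n" and v0: "v \<noteq> 0\<^sub>v ?n" and Av: "A *\<^sub>v v = 0\<^sub>v ?n"
    using det_0_iff_vec_prod_zero_field[OF A] by blast
  interpret vec_space "TYPE('a)" ?n .
  define b where "b = basis_completion v"
  note bc = basis_completion[OF v v0, folded b_def]
  define W where "W = mat_of_cols ?n b"
  have W: "W \<in> carrier_mat ?n ?n"
    unfolding W_def using bc mat_of_cols_carrier(1)[of ?n b] by simp
  have colsW: "cols W = b"
    unfolding W_def using bc by (intro cols_mat_of_cols) auto
  have "lin_indpt (set (cols W))" "distinct (cols W)"
    using bc colsW unfolding basis_def by auto
  then have "rank W = ?n"
    using lin_indpt_full_rank[OF W] by blast
  then have "det W \<noteq> 0" using det_rank_iff[OF W] by simp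
  then obtain W' where W': "W' \<in> carrier_mat ?n ?n" and WW': "W * W' = 1\<^sub>m ?n"
    and W'W: "W' * W = 1\<^sub>m ?n"
    using det_non_zero_imp_unit[OF W, of "()"] W
    unfolding Units_def by (auto simp: ring_mat_def)
  define A' where "A' = W' * A * W"
  have A': "A' \<in> carrier_mat ?n ?n" unfolding A'_def using W W' A by auto
  have wit: "similar_mat_wit A' A W' W"
    by (rule similar_mat_witI[of _ _ ?n], insert W W' A A' W'W WW', auto simp: A'_def)
  have sim: "similar_mat A A'"
    using wit similar_mat_sym unfolding similar_mat_def by blast
  have colW0: "col W 0 = v"
  proof -
    have "b \<noteq> []" using bc by auto
    then have "b ! 0 = v" using bc by (simp add: hd_conv_nth)
    then show ?thesis unfolding W_def using bc v by (subst col_mat_of_cols) auto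
  qed
  have "col A' 0 = (W' * A) *\<^sub>v col W 0"
    unfolding A'_def using W W' A by (intro col_mult2[of _ ?n ?n _ ?n]) auto
  also have "\<dots> = 0\<^sub>v ?n"
    unfolding colW0 using W' A v Av by (subst assoc_mult_mat_vec[of _ ?n ?n _ ?n]) auto
  finally have col0: "col A' 0 = 0\<^sub>v ?n" .
  obtain A1 A2 A0 A3 where split: "split_block A' 1 1 = (A1, A2, A0, A3)"
    by (cases "split_block A' 1 1") auto
  have "dim_row A' = 1 + m" "dim_col A' = 1 + m" using A' by auto
  note sb = split_block[OF split this]
  have A0: "A0 = 0\<^sub>m m 1"
  proof (rule eq_matI)
    fix i j assume ij: "i < dim_row (0\<^sub>m m 1 :: 'a mat)" "j < dim_col (0\<^sub>m m 1 :: 'a mat)"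
    have "A0 $$ (i, j) = A' $$ (Suc i, 0)"
      using split[unfolded split_block_def Let_def] ij A' by auto
    also have "\<dots> = col A' 0 $ Suc i" using ij A' by auto
    finally show "A0 $$ (i, j) = 0\<^sub>m m 1 $$ (i, j)" using col0 ij by simp
  qed (use sb in auto)
  have A'eq: "A' = four_block_mat A1 A2 (0\<^sub>m m 1) A3" using sb A0 by simp
  have pow0: "A' ^\<^sub>m k = 0\<^sub>m ?n ?n"
  proof -
    have "A' ^\<^sub>m k = W' * A ^\<^sub>m k * W"
      using similar_mat_wit_pow[OF wit, of k] unfolding similar_mat_wit_def Let_def by auto
    then show ?thesis using Suc.prems(2) W W' by simp
  qed
  obtain X Y where X: "X \<in> carrier_mat 1 1" and Y: "Y \<in> carrier_mat 1 m"
    and XY: "A' ^\<^sub>m k = four_block_mat X Y (0\<^sub>m m 1) (A3 ^\<^sub>m k)"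
    using pow_four_block_lower_right[OF sb(1,2,4), of k] unfolding A'eq by blast
  have "A3 ^\<^sub>m k = 0\<^sub>m m m"
  proof (rule eq_matI)
    fix i j assume ij: "i < dim_row (0\<^sub>m m m :: 'a mat)" "j < dim_col (0\<^sub>m m m :: 'a mat)"
    have A3k: "A3 ^\<^sub>m k \<in> carrier_mat m m" using sb(4) by simp
    have "(A3 ^\<^sub>m k) $$ (i, j) = (A' ^\<^sub>m k) $$ (Suc i, Suc j)"
      unfolding XY using X ij A3k by (subst index_mat_four_block(1)) auto
    then show "(A3 ^\<^sub>m k) $$ (i, j) = 0\<^sub>m m m $$ (i, j)" using pow0 ij by simp
  qed (use sb(4) in auto)
  then obtain U3 where U3: "U3 \<in> carrier_mat m m" "upper_triangular U3" "similar_mat A3 U3"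
    using Suc.IH[OF sb(4)] by blast
  obtain B0 where B0: "B0 \<in> carrier_mat 1 m"
    and simB: "similar_mat A' (four_block_mat A1 B0 (0\<^sub>m m 1) U3)"
    using similar_mat_four_block_0_ex[OF similar_mat_refl[OF sb(1)] U3(3) sb(2) sb(1) sb(4)]
    unfolding A'eq by blast
  have ut: "upper_triangular (four_block_mat A1 B0 (0\<^sub>m m 1) U3)"
    using sb(1) by (intro upper_triangular_four_block[OF sb(1) U3(1) _ U3(2)]) auto
  have "four_block_mat A1 B0 (0\<^sub>m m 1) U3 \<in> carrier_mat ?n ?n"
    using four_block_carrier_mat[OF sb(1) U3(1)] by simp
  then show ?case using ut similar_mat_trans[OF sim simB] by blast
qed

lemma nilpotent_jordan_nf:
  fixes B :: "'a::field mat"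
  assumes "nilpotent_mat B"
  shows "\<exists>n_as. jordan_nf B n_as"
proof -
  obtain k where k: "B ^\<^sub>m k = 0\<^sub>m (dim_row B) (dim_row B)"
    using assms unfolding nilpotent_mat_def by blast
  have "dim_col B = dim_row B"
    using assms unfolding nilpotent_mat_def by simp
  then have B: "B \<in> carrier_mat (dim_row B) (dim_row B)"
    by (rule carrier_matI[OF refl])
  obtain U where U: "U \<in> carrier_mat (dim_row B) (dim_row B)" "upper_triangular U"
    and BU: "similar_mat B U"
    using nilpotent_similar_upper_triangular[OF B k] by blast
  have nf: "jordan_nf U (triangular_to_jnf_vector U)"
    by (rule triangular_to_jnf_vector[OF U])
  then have "similar_mat B (jordan_matrix (triangular_to_jnf_vector U))"
    unfolding jordan_nf_def by (blast intro: similar_mat_trans[OF BU])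
  then have "jordan_nf B (triangular_to_jnf_vector U)"
    using nf unfolding jordan_nf_def by blast
  then show ?thesis ..
qed

end

(* Pass to a Jordan basis of B and give every basis vector the pair (a, r) of its distances to the
   two ends of its block; the block has size a + r + 1. A matrix commuting with B has nonzero
   entries only at (p, q) with a_p <= a_q and r_p >= r_q. If it is nilpotent, then so are its
   diagonal blocks for this preorder, and therefore its L-th power vanishes as soon as no set of
   pairwise comparable basis vectors has more than L elements. Conversely, let N have entry 1
   at (p, q) if (a_p, r_p) and (a_q, r_q) are related and distinct, or equal with p < q, and entry 0
   otherwise. Then N commutes with B, and a comparable set with L elements is a path of N, so
   the power L - 1 of N, whose entries count paths, is nonzero in characteristic 0.

   It remains to find the largest comparable sets. Let w M be the number of blocks of size M. Among
   the sizes k from the smallest one met by the set up to the largest part, take one maximizing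
   w k + w (k + 1). The set then has at most as many elements as the one made of all basis vectors
   in blocks of size k or k + 1 and the first and last vectors of all larger blocks. *)

theory Submission
  imports Defs
begin

section \<open>Coordinates on Jordan bases\<close>

text \<open>Index \<open>p\<close> of the Jordan matrix with blocks \<open>ks\<close> gets the pair of its distances to
  the first and to the last index of its block.\<close>

fun block_coords :: "nat list \<Rightarrow> (nat \<times> nat) list" where
  "block_coords [] = []"
| "block_coords (k # ks) = map (\<lambda>i. (i, k - 1 - i)) [0..<k] @ block_coords ks"

lemma length_block_coords [simp]: "length (block_coords ks) = sum_list ks"
  by (induction ks) auto

text \<open>A block of size \<open>k > 0\<close> lists every pair with sum \<open>k - 1\<close> once
  and no other pair, so counting \<open>(x, y)\<close> amounts to counting blocks of size
  \<open>x + y + 1\<close>.\<close>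

lemma count_block_coords: "count_list (block_coords ks) (x, y) = count_list ks (x + y + 1)"
proof (induction ks)
  case (Cons k ks)
  have "distinct (map (\<lambda>i. (i, k - 1 - i)) [0..<k])"
    by (auto simp: distinct_map inj_on_def)
  moreover have "(x, y) \<in> set (map (\<lambda>i. (i, k - 1 - i)) [0..<k]) \<longleftrightarrow> k = x + y + 1"
    by (auto simp: image_iff)
  ultimately have "count_list (map (\<lambda>i. (i, k - 1 - i)) [0..<k]) (x, y)
      = (if k = x + y + 1 then 1 else 0)"
    by (metis count_mset distinct_count_atmost_1)
  then show ?case using Cons by simp
qed simp

lemma block_coords_Suc:
  assumes "p < sum_list ks" "snd (block_coords ks ! p) > 0"
  shows "Suc p < sum_list ks"
    and "fst (block_coords ks ! Suc p) = Suc (fst (block_coords ks ! p))"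
    and "snd (block_coords ks ! p) = Suc (snd (block_coords ks ! Suc p))"
proof -
  have "Suc p < sum_list ks \<and> fst (block_coords ks ! Suc p) = Suc (fst (block_coords ks ! p))
    \<and> snd (block_coords ks ! p) = Suc (snd (block_coords ks ! Suc p))"
    using assms
  proof (induction ks arbitrary: p)
    case (Cons k ks)
    show ?case
    proof (cases "p < k")
      case True
      then show ?thesis using Cons.prems by (auto simp: nth_append)
    next
      case False
      then show ?thesis using Cons.prems Cons.IH[of "p - k"]
        by (auto simp: nth_append Suc_diff_le not_less less_diff_conv2)
    qed
  qed simp
  then show "Suc p < sum_list ks"
    and "fst (block_coords ks ! Suc p) = Suc (fst (block_coords ks ! p))"
    and "snd (block_coords ks ! p) = Suc (snd (block_coords ks ! Suc p))" by auto
qed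

lemma fst_block_coords_0: "0 < sum_list ks \<Longrightarrow> fst (block_coords ks ! 0) = 0"
proof (induction ks)
  case (Cons k ks)
  then show ?case by (cases "k = 0") (auto simp: nth_append)
qed simp

lemma block_coords_pred:
  assumes "Suc p < sum_list ks" "fst (block_coords ks ! Suc p) > 0"
  shows "snd (block_coords ks ! p) > 0"
  using assms
proof (induction ks arbitrary: p)
  case (Cons k ks)
  show ?case
  proof (cases "p < k")
    case True
    then show ?thesis using Cons.prems fst_block_coords_0[of ks]
      by (cases "Suc p < k") (auto simp: nth_append not_less less_Suc_eq)
  next
    case False
    then show ?thesis using Cons.prems Cons.IH[of "p - k"]
      by (auto simp: nth_append Suc_diff_le)
  qed
qed simp

lemma block_coords_predE:
  assumes "q < sum_list ks" "fst (block_coords ks ! q) > 0"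
  obtains p where "q = Suc p" "snd (block_coords ks ! p) > 0"
    "fst (block_coords ks ! q) = Suc (fst (block_coords ks ! p))"
proof -
  have "q \<noteq> 0"
  proof
    assume "q = 0"
    then show False using assms fst_block_coords_0[of ks] by simp
  qed
  then obtain p where p: "q = Suc p" using not0_implies_Suc by blast
  have r: "snd (block_coords ks ! p) > 0" using block_coords_pred[of p ks] assms p by simp
  then show ?thesis using that[OF p r] block_coords_Suc(2)[OF _ r] assms(1) p by simp
qed

text \<open>The ones of a block with eigenvalue 0 stand right of the diagonal in every row except
  the last row of the block, which is the one with second coordinate 0.\<close>

lemma jordan_matrix_coords:
  assumes "p < sum_list ks" "q < sum_list ks"
  shows "(jordan_matrix (map (\<lambda>k. (k, 0)) ks) :: 'a::{zero,one} mat) $$ (p, q) =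
    (if q = Suc p \<and> snd (block_coords ks ! p) > 0 then 1 else 0)"
  using assms
proof (induction ks arbitrary: p q)
  case (Cons k ks)
  have s: "sum_list (map (fst \<circ> (\<lambda>k. (k, 0::'a))) ks) = sum_list ks" 
    by (simp add: comp_def)
  have d: "dim_row (jordan_matrix (map (\<lambda>k. (k, 0::'a)) ks)) = sum_list ks"
     "dim_col (jordan_matrix (map (\<lambda>k. (k, 0::'a)) ks)) = sum_list ks"
    by (simp_all add: s)
  show ?case
  proof (cases "p < k")
    case True
    then show ?thesis using Cons.prems
      by (auto simp: jordan_matrix_Cons s nth_append)
  next
    case False
    then show ?thesis using Cons.prems Cons.IH[of "p - k" "q - k"]
      by (auto simp: jordan_matrix_Cons s nth_append)
  qed
qed simp

text \<open>The eigenvalue \<open>a\<close> of a Jordan block has an eigenvector \<open>v\<close>,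
  and the vanishing power of \<open>A\<close> multiplies \<open>v\<close> by \<open>a ^ k\<close>,
  which must therefore be 0.\<close>

lemma nilpotent_jordan_nf_zero:
  fixes A :: "'a::field mat"
  assumes "A \<in> carrier_mat n n" "A ^\<^sub>m k = 0\<^sub>m n n"
  obtains ks where "jordan_nf A (map (\<lambda>k. (k, 0)) ks)"
proof -
  have "nilpotent_mat A" using assms unfolding nilpotent_mat_def by auto
  then obtain n_as where nf: "jordan_nf A n_as" using nilpotent_jordan_nf by blast
  have "a = 0" if "(m, a) \<in> set n_as" for m a
  proof -
    \<comment> \<open>A block of positive size puts \<open>a\<close> among the roots of the
      characteristic polynomial.\<close>
    have "m \<noteq> 0" using nf that unfolding jordan_nf_def by force
    then have "poly (char_poly A) a = 0"
      using that unfolding jordan_nf_char_poly[OF nf] 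
      by (auto simp: poly_prod_list prod_list_zero_iff image_iff intro!: bexI[of _ "(m, a)"])
    then have "eigenvalue A a" using eigenvalue_root_char_poly[OF assms(1)] by simp
    then obtain v where v: "v \<in> carrier_vec n" "v \<noteq> 0\<^sub>v n" "A *\<^sub>v v = a \<cdot>\<^sub>v v"
      using assms(1) unfolding eigenvalue_def eigenvector_def by auto
    have "A ^\<^sub>m j *\<^sub>v v = a ^ j \<cdot>\<^sub>v v" for j
    proof (induction j)
      case 0
      then show ?case using v assms by simp
    next
      case (Suc j)
      have "A ^\<^sub>m Suc j *\<^sub>v v = A ^\<^sub>m j *\<^sub>v (A *\<^sub>v v)"
        using assms v by (simp add: assoc_mult_mat_vec[of _ n n _ n])
      also have "\<dots> = a \<cdot>\<^sub>v (A ^\<^sub>m j *\<^sub>v v)"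
        unfolding v using assms v by (intro mult_mat_vec[of _ n n]) auto
      finally show ?case by (simp add: Suc smult_smult_assoc)
    qed
    moreover have "0\<^sub>m n n *\<^sub>v v = 0\<^sub>v n" using v(1) by (intro eq_vecI) auto
    ultimately have *: "a ^ k \<cdot>\<^sub>v v = 0\<^sub>v n" using assms(2) by metis
    obtain i where i: "i < n" "v $ i \<noteq> 0" using v(1,2) by (metis eq_vecI carrier_vecD index_zero_vec)
    have "(a ^ k \<cdot>\<^sub>v v) $ i = 0" unfolding * using i by simp
    then show "a = 0" using i v(1) by simp
  qed
  then have "n_as = map (\<lambda>k. (k, 0)) (map fst n_as)"
    by (auto simp: comp_def intro!: map_idI[symmetric])
  then show ?thesis using nf that by metis
qed

section \<open>Powers of nilpotent matrices\<close>

lemma pow_mat_add: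
  assumes "A \<in> carrier_mat n n"
  shows "A ^\<^sub>m (j + k) = A ^\<^sub>m j * A ^\<^sub>m k"
proof (induction k)
  case (Suc k)
  then show ?case using assms by (simp add: assoc_mult_mat[of _ n n _ n _ n])
qed (use assms in simp)

text \<open>A nonzero entry of the \<open>k\<close>-th power needs a walk along \<open>k\<close>
  nonzero entries of \<open>A\<close>, and each of them raises \<open>\<phi>\<close> by at least
  1.\<close>

lemma mat_pow_nonzero_potential:
  fixes A :: "'a::semiring_1 mat" and \<phi> :: "nat \<Rightarrow> nat"
  assumes A: "A \<in> carrier_mat n n"
    and incr: "\<And>p q. p < n \<Longrightarrow> q < n \<Longrightarrow> A $$ (p, q) \<noteq> 0 \<Longrightarrow> \<phi> p < \<phi> q"
    and "p < n" "q < n" "(A ^\<^sub>m k) $$ (p, q) \<noteq> 0"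
  shows "\<phi> p + k \<le> \<phi> q"
  using assms(3-)
proof (induction k arbitrary: q)
  case 0
  then show ?case using A by (auto split: if_splits)
next
  case (Suc k)
  have "(\<Sum>x<n. (A ^\<^sub>m k) $$ (p, x) * A $$ (x, q)) \<noteq> 0"
    using Suc.prems A by (simp add: scalar_prod_def lessThan_atLeast0)
  then obtain x where "x < n" "(A ^\<^sub>m k) $$ (p, x) * A $$ (x, q) \<noteq> 0"
    by (meson lessThan_iff sum.not_neutral_contains_not_neutral)
  then have x: "x < n" "(A ^\<^sub>m k) $$ (p, x) \<noteq> 0" "A $$ (x, q) \<noteq> 0" by auto
  show ?case using Suc.IH[OF Suc.prems(1) x(1,2)] incr[OF x(1) Suc.prems(2) x(3)] by simp
qed

section \<open>Conjugation, and nilpotency bounded by the dimension\<close>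

lemma mat_conj_mult:
  fixes U :: "'a::semiring_1 mat"
  assumes U: "U \<in> carrier_mat n n" and V: "V \<in> carrier_mat n n" and VU: "V * U = 1\<^sub>m n"
    and X: "X \<in> carrier_mat n n" and Y: "Y \<in> carrier_mat n n"
  shows "(U * X * V) * (U * Y * V) = U * (X * Y) * V"
proof -
  note assoc = assoc_mult_mat[of _ n n _ n _ n]
  have YV: "Y * V \<in> carrier_mat n n" using Y V by simp
  have "V * (U * (Y * V)) = Y * V"
    using assoc[OF V U YV] left_mult_one_mat[OF YV] unfolding VU by simp
  then show ?thesis using U V X Y by (simp add: assoc)
qed

lemma similar_mat_wit_conj:
  fixes P :: "'a::semiring_1 mat"
  assumes P: "P \<in> carrier_mat n n" and Q: "Q \<in> carrier_mat n n"
    and PQ: "P * Q = 1\<^sub>m n" and QP: "Q * P = 1\<^sub>m n" and A: "A \<in> carrier_mat n n"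
  shows "similar_mat_wit A (Q * A * P) P Q"
proof (rule similar_mat_witI[OF PQ QP _ A _ P Q])
  note assoc = assoc_mult_mat[of _ n n _ n _ n]
  have "P * (Q * A) = A" using assoc[OF P Q A] left_mult_one_mat[OF A] unfolding PQ by simp
  moreover have "A * (P * Q) = A" unfolding PQ using A by simp
  ultimately have "P * (Q * (A * (P * Q))) = A" by simp
  then show "A = P * (Q * A * P) * Q" using P Q A by (simp add: assoc)
qed (use P Q A in simp)

lemma similar_mat_wit_pow_zero_iff:
  fixes A :: "'a::semiring_1 mat"
  assumes wit: "similar_mat_wit A B P Q" and A: "A \<in> carrier_mat n n"
  shows "A ^\<^sub>m k = 0\<^sub>m n n \<longleftrightarrow> B ^\<^sub>m k = 0\<^sub>m n n"
proof -
  note D = similar_mat_witD2[OF A wit]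
  have "A ^\<^sub>m k = P * B ^\<^sub>m k * Q" by (rule similar_mat_wit_pow_id[OF wit])
  moreover have "B ^\<^sub>m k = Q * A ^\<^sub>m k * P"
    by (rule similar_mat_wit_pow_id[OF similar_mat_wit_sym[OF wit]])
  moreover have "P * 0\<^sub>m n n * Q = 0\<^sub>m n n" "Q * 0\<^sub>m n n * P = 0\<^sub>m n n"
    using D(6,7) by auto
  ultimately show ?thesis by (intro iffI) simp_all
qed

text \<open>The Jordan matrix is strictly upper triangular, so a nonzero entry of its
  \<open>n\<close>-th power would join two indices below \<open>n\<close> that differ by at least
  \<open>n\<close>.\<close>

lemma nilpotent_pow_dim:
  fixes A :: "'a::field mat"
  assumes A: "A \<in> carrier_mat n n" and nil: "A ^\<^sub>m k = 0\<^sub>m n n"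
  shows "A ^\<^sub>m n = 0\<^sub>m n n"
proof -
  obtain ks where nf: "jordan_nf A (map (\<lambda>k. (k, 0)) ks)"
    using nilpotent_jordan_nf_zero[OF A nil] .
  define J where "J = (jordan_matrix (map (\<lambda>k. (k, 0)) ks) :: 'a mat)"
  obtain P Q where wit: "similar_mat_wit A J P Q"
    using nf unfolding jordan_nf_def similar_mat_def J_def by blast
  note D = similar_mat_witD2[OF A wit]
  have J: "J \<in> carrier_mat n n" using D(5) .
  have n: "n = sum_list ks"
  proof -
    have "dim_row J = sum_list ks" by (simp add: J_def comp_def)
    then show ?thesis using J by simp
  qed
  have "J ^\<^sub>m n = 0\<^sub>m n n"
  proof (rule eq_matI)
    fix p q assume pq: "p < dim_row (0\<^sub>m n n :: 'a mat)" "q < dim_col (0\<^sub>m n n :: 'a mat)"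
    have "(J ^\<^sub>m n) $$ (p, q) = 0"
    proof (rule ccontr)
      assume "(J ^\<^sub>m n) $$ (p, q) \<noteq> 0"
      then have "p + n \<le> q"
        using pq J jordan_matrix_coords[where 'a = 'a, of _ ks]
        by (intro mat_pow_nonzero_potential[of J n "\<lambda>x. x"])
           (auto simp: n J_def[symmetric] split: if_splits)
      then show False using pq by simp
    qed
    then show "(J ^\<^sub>m n) $$ (p, q) = 0\<^sub>m n n $$ (p, q)" using pq by simp
  qed (use J in auto)
  then show ?thesis using similar_mat_wit_pow_zero_iff[OF wit A] by simp
qed

section \<open>Matrices supported in a preorder\<close>

lemma mat_mult_index_sum:
  assumes "A \<in> carrier_mat n n" "B \<in> carrier_mat n n" "p < n" "q < n"
  shows "(A * B) $$ (p, q) = (\<Sum>x<n. A $$ (p, x) * B $$ (x, q))"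
  using assms by (simp add: scalar_prod_def lessThan_atLeast0)

lemma pow_support:
  fixes A :: "'a::semiring_1 mat" and R :: "nat \<Rightarrow> nat \<Rightarrow> bool"
  assumes A: "A \<in> carrier_mat n n"
    and refl: "\<And>p. R p p" and trans: "\<And>p q s. R p q \<Longrightarrow> R q s \<Longrightarrow> R p s"
    and supp: "\<And>p q. p < n \<Longrightarrow> q < n \<Longrightarrow> A $$ (p, q) \<noteq> 0 \<Longrightarrow> R p q"
    and "p < n" "q < n" "(A ^\<^sub>m k) $$ (p, q) \<noteq> 0"
  shows "R p q"
  using assms(6-)
proof (induction k arbitrary: q)
  case 0
  then show ?case using A refl \<open>p < n\<close> by (auto split: if_splits)
next
  case (Suc k)
  have "(\<Sum>x<n. (A ^\<^sub>m k) $$ (p, x) * A $$ (x, q)) \<noteq> 0"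
    using Suc.prems A \<open>p < n\<close> by (simp add: scalar_prod_def lessThan_atLeast0)
  then obtain x where "x < n" "(A ^\<^sub>m k) $$ (p, x) * A $$ (x, q) \<noteq> 0"
    by (meson lessThan_iff sum.not_neutral_contains_not_neutral)
  then have "x < n" "(A ^\<^sub>m k) $$ (p, x) \<noteq> 0" "A $$ (x, q) \<noteq> 0" by auto
  then show ?case using Suc.IH[of x] supp[of x q] trans Suc.prems(1) by blast
qed

text \<open>By the convexity hypothesis, no term that leaves \<open>Q\<close> contributes to a
  product between points of \<open>Q\<close>. Passing to the submatrix on \<open>Q\<close> therefore
  commutes with powers, so the submatrix is nilpotent and \<open>nilpotent_pow_dim\<close> applies
  to it.\<close>

lemma diagonal_block_pow_zero:
  fixes A :: "'a::field mat"
  assumes A: "A \<in> carrier_mat n n" and nil: "A ^\<^sub>m k = 0\<^sub>m n n"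
    and Q: "Q \<subseteq> {..<n}"
    and convex: "\<And>j p x q. p \<in> Q \<Longrightarrow> q \<in> Q \<Longrightarrow> x < n \<Longrightarrow>
      (A ^\<^sub>m j) $$ (p, x) \<noteq> 0 \<Longrightarrow> A $$ (x, q) \<noteq> 0 \<Longrightarrow> x \<in> Q"
    and "p \<in> Q" "q \<in> Q"
  shows "(A ^\<^sub>m card Q) $$ (p, q) = 0"
proof -
  define d where "d = card Q"
  have fin: "finite Q" using Q finite_subset by blast
  then obtain f where f: "bij_betw f {..<d} Q"
    unfolding d_def lessThan_atLeast0 using ex_bij_betw_nat_finite by blast
  then have fQ: "f i \<in> Q" if "i < d" for i using that by (auto simp: bij_betw_def)
  then have fn: "f i < n" if "i < d" for i using that Q by auto
  define N where "N = mat d d (\<lambda>(i, j). A $$ (f i, f j))"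
  have N: "N \<in> carrier_mat d d" by (simp add: N_def)
  have block: "(N ^\<^sub>m j) $$ (i, i') = (A ^\<^sub>m j) $$ (f i, f i')" if "i < d" "i' < d" for i i' j
    using that
  proof (induction j arbitrary: i')
    case 0
    then show ?case using f fn A N by (auto simp: bij_betw_def inj_on_def)
  next
    case (Suc j)
    have "(N ^\<^sub>m Suc j) $$ (i, i') = (\<Sum>x<d. (A ^\<^sub>m j) $$ (f i, f x) * A $$ (f x, f i'))"
      using Suc N by (simp add: mat_mult_index_sum[of _ d] N_def del: index_mult_mat)
    also have "\<dots> = (\<Sum>x\<in>Q. (A ^\<^sub>m j) $$ (f i, x) * A $$ (x, f i'))"
      by (rule sum.reindex_bij_betw[OF f])
    also have "\<dots> = (\<Sum>x<n. (A ^\<^sub>m j) $$ (f i, x) * A $$ (x, f i'))"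
      using Q convex[OF fQ[OF Suc.prems(1)] fQ[OF Suc.prems(2)], of _ j]
      by (intro sum.mono_neutral_left) auto
    finally show ?case
      using A fn Suc.prems by (simp add: mat_mult_index_sum[of _ n] del: index_mult_mat)
  qed
  have "N ^\<^sub>m k = 0\<^sub>m d d"
    using N block[of _ _ k] nil fn by (intro eq_matI) auto
  then have "N ^\<^sub>m d = 0\<^sub>m d d" by (rule nilpotent_pow_dim[OF N])
  moreover obtain i i' where "i < d" "i' < d" "p = f i" "q = f i'"
    using f \<open>p \<in> Q\<close> \<open>q \<in> Q\<close> unfolding bij_betw_def by blast
  ultimately show ?thesis using block[of i i' d] by (simp add: d_def)
qed

text \<open>Row \<open>p\<close> is treated by induction on the up-set of \<open>p\<close>: if \<open>Q\<close> is the equivalence class of \<open>p\<close>,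
  the first \<open>card Q\<close> factors kill the diagonal block of \<open>Q\<close>, so that row \<open>p\<close> moves strictly
  above \<open>Q\<close>.\<close>

lemma nilpotent_pow_zero_chain_bound:
  fixes A :: "'a::field mat" and R :: "nat \<Rightarrow> nat \<Rightarrow> bool"
  assumes A: "A \<in> carrier_mat n n" and nil: "A ^\<^sub>m k = 0\<^sub>m n n"
    and refl: "\<And>p. R p p" and trans: "\<And>p q s. R p q \<Longrightarrow> R q s \<Longrightarrow> R p s"
    and supp: "\<And>p q. p < n \<Longrightarrow> q < n \<Longrightarrow> A $$ (p, q) \<noteq> 0 \<Longrightarrow> R p q"
    and chains: "\<And>S. S \<subseteq> {..<n} \<Longrightarrow> (\<forall>p\<in>S. \<forall>q\<in>S. R p q \<or> R q p) \<Longrightarrow> card S \<le> L"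
  shows "A ^\<^sub>m L = 0\<^sub>m n n"
proof -
  have psupp: "R p q" if "p < n" "q < n" "(A ^\<^sub>m j) $$ (p, q) \<noteq> 0" for p q j
    by (rule pow_support[of A n R p q j]) (fact A refl trans supp that)+
  \<comment> \<open>\<open>L\<close> is generalized and the bound is asked only of comparable sets
    above \<open>p\<close>: a point strictly above \<open>p\<close> has fewer factors left, but also
    smaller comparable sets above it.\<close>
  have row: "(A ^\<^sub>m L) $$ (p, q) = 0"
    if "p < n" "q < n"
      "\<And>S. S \<subseteq> {x. x < n \<and> R p x} \<Longrightarrow> (\<forall>u\<in>S. \<forall>v\<in>S. R u v \<or> R v u) \<Longrightarrow> card S \<le> L"
    for p q L
    using that
  proof (induction "card {x. x < n \<and> R p x}" arbitrary: p L rule: less_induct)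
    case less
    define Q where "Q = {x. x < n \<and> R p x \<and> R x p}"
    define d where "d = card Q"
    have QC: "\<forall>u\<in>Q. \<forall>v\<in>Q. R u v" unfolding Q_def using trans[of _ p] by blast
    have "d \<le> L" unfolding d_def
    proof (rule less.prems(3))
      show "Q \<subseteq> {x. x < n \<and> R p x}" by (auto simp: Q_def)
    qed (use QC in blast)
    have diag: "(A ^\<^sub>m d) $$ (p, x) = 0" if "x \<in> Q" for x
      unfolding d_def
    proof (rule diagonal_block_pow_zero[OF A nil _ _ _ that])
      show "Q \<subseteq> {..<n}" "p \<in> Q" using less.prems(1) refl by (auto simp: Q_def)
      fix j u x v
      assume *: "u \<in> Q" "v \<in> Q" "x < n" "(A ^\<^sub>m j) $$ (u, x) \<noteq> 0" "A $$ (x, v) \<noteq> 0"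
      then have "R u x" "R x v" using psupp[of u x j] supp[of x v] by (auto simp: Q_def)
      then show "x \<in> Q" using * trans[of p u x] trans[of x v p] unfolding Q_def by blast
    qed
    \<comment> \<open>The middle index \<open>x\<close> is strictly above \<open>p\<close>, where
      the induction hypothesis kills the second factor, or it lies in \<open>Q\<close> or not above
      \<open>p\<close>, where the first factor vanishes by \<open>diag\<close> or by the
      support.\<close>
    have "(A ^\<^sub>m d) $$ (p, x) * (A ^\<^sub>m (L - d)) $$ (x, q) = 0" if x: "x < n" for x
    proof (cases "R p x \<and> x \<notin> Q")
      case True
      then have px: "R p x" "\<not> R x p" using x by (auto simp: Q_def)
      have "(A ^\<^sub>m (L - d)) $$ (x, q) = 0"
      proof (rule less.hyps[OF _ x less.prems(2)])
        show "card {y. y < n \<and> R x y} < card {y. y < n \<and> R p y}"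
        proof (rule psubset_card_mono)
          have "{y. y < n \<and> R x y} \<subseteq> {y. y < n \<and> R p y}" using px(1) trans[of p x] by blast
          moreover have "p \<in> {y. y < n \<and> R p y} - {y. y < n \<and> R x y}"
            using px(2) less.prems(1) refl by simp
          ultimately show "{y. y < n \<and> R x y} \<subset> {y. y < n \<and> R p y}" by blast
        qed simp
        \<comment> \<open>Joining \<open>Q\<close> to a comparable set above \<open>x\<close> gives
          one above \<open>p\<close> with \<open>d\<close> more elements, which leaves
          \<open>L - d\<close> for \<open>S\<close>.\<close>
        fix S assume S: "S \<subseteq> {y. y < n \<and> R x y}" "\<forall>u\<in>S. \<forall>v\<in>S. R u v \<or> R v u"
        have "finite S" using S(1) by (rule finite_subset) simp
        have "S \<inter> Q = {}" using S(1) px(2) trans[of x _ p] unfolding Q_def by blast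
        then have "card (S \<union> Q) = card S + d"
          unfolding d_def using \<open>finite S\<close> by (intro card_Un_disjoint) (auto simp: Q_def)
        moreover have "card (S \<union> Q) \<le> L"
        proof (rule less.prems(3))
          show "S \<union> Q \<subseteq> {x. x < n \<and> R p x}" using S(1) px(1) trans[of p x] unfolding Q_def by blast
          have "R u v" if "u \<in> Q" "v \<in> S" for u v
            using that S(1) trans[of u p v] trans[of p x v] px(1) unfolding Q_def by blast
          then show "\<forall>u\<in>S \<union> Q. \<forall>v\<in>S \<union> Q. R u v \<or> R v u" using S(2) QC by blast
        qed
        ultimately show "card S \<le> L - d" by simp
      qed
      then show ?thesis by simp
    next
      case False
      then show ?thesis using diag psupp[OF less.prems(1) x] by auto
    qed
    then have "(\<Sum>x<n. (A ^\<^sub>m d) $$ (p, x) * (A ^\<^sub>m (L - d)) $$ (x, q)) = 0"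
      by (intro sum.neutral) auto
    then have "(A ^\<^sub>m d * A ^\<^sub>m (L - d)) $$ (p, q) = 0"
      using A less.prems(1,2) by (simp add: mat_mult_index_sum[of _ n] del: index_mult_mat)
    then show ?case using pow_mat_add[OF A, of d "L - d"] \<open>d \<le> L\<close> by simp
  qed
  show ?thesis
  proof (rule eq_matI)
    fix p q assume "p < dim_row (0\<^sub>m n n :: 'a mat)" "q < dim_col (0\<^sub>m n n :: 'a mat)"
    then show "(A ^\<^sub>m L) $$ (p, q) = 0\<^sub>m n n $$ (p, q)"
      using row[of p q L] chains by force
  qed (use A in auto)
qed

text \<open>Running through \<open>S\<close> in increasing order gives a path along
  \<open>card S - 1\<close> positive entries. Over the naturals nothing can cancel it.\<close>

lemma nat_mat_pow_pos_chain:
  fixes N :: "nat mat" and R :: "nat \<Rightarrow> nat \<Rightarrow> bool"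
  assumes N: "N \<in> carrier_mat n n"
    and pos: "\<And>p q. p \<in> S \<Longrightarrow> q \<in> S \<Longrightarrow> R p q \<Longrightarrow> N $$ (p, q) > 0"
    and trans: "\<And>p q s. R p q \<Longrightarrow> R q s \<Longrightarrow> R p s"
    and irrefl: "\<And>p. \<not> R p p"
    and S: "S \<subseteq> {..<n}" "S \<noteq> {}" and total: "\<forall>p\<in>S. \<forall>q\<in>S. p = q \<or> R p q \<or> R q p"
  shows "\<exists>p\<in>S. \<exists>q\<in>S. (\<forall>x\<in>S. p = x \<or> R p x) \<and> (N ^\<^sub>m (card S - 1)) $$ (p, q) > 0"
proof -
  have fin: "finite S" using S(1) finite_subset by blast
  from fin S(2) show ?thesis using pos S(1) total
  proof (induction "card S" arbitrary: S)
    case (Suc m)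
    have "\<exists>p\<in>S. \<forall>x\<in>S. p = x \<or> R p x"
      using Suc.prems(1,2,5)
    proof (induction S rule: finite_ne_induct)
      case (insert y F)
      then obtain p where "p \<in> F" "\<forall>x\<in>F. p = x \<or> R p x" by blast
      then show ?case using insert.prems trans by (metis insert_iff)
    qed simp
    then obtain p where p: "p \<in> S" "\<forall>x\<in>S. p = x \<or> R p x" by blast
    define S' where "S' = S - {p}"
    have card: "card S' = m" using Suc p(1) by (simp add: S'_def)
    show ?case
    proof (cases "S' = {}")
      case True
      then have "S = {p}" using p(1) by (auto simp: S'_def)
      then show ?thesis using N Suc.prems(4) p by auto
    next
      case False
      have "\<exists>p'\<in>S'. \<exists>q\<in>S'. (\<forall>x\<in>S'. p' = x \<or> R p' x) \<and> (N ^\<^sub>m (card S' - 1)) $$ (p', q) > 0"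
        using Suc.prems False card by (intro Suc.hyps) (auto simp: S'_def)
      then obtain p' q where *: "p' \<in> S'" "q \<in> S'" "(N ^\<^sub>m (m - 1)) $$ (p', q) > 0"
        using card by blast
      have "m \<noteq> 0" using card False Suc.prems(1) by (auto simp: S'_def)
      have n: "p < n" "p' < n" "q < n" using p(1) *(1,2) Suc.prems(4) by (auto simp: S'_def)
      have "N $$ (p, p') > 0" using Suc.prems(3) p *(1) by (auto simp: S'_def)
      \<comment> \<open>The path found in \<open>S'\<close> is prolonged at its start by the step
        from the least element \<open>p\<close>; its product is one summand of the matrix
        product.\<close>
      then have "0 < N $$ (p, p') * (N ^\<^sub>m (m - 1)) $$ (p', q)" using *(3) by simp
      also have "\<dots> \<le> (\<Sum>x<n. N $$ (p, x) * (N ^\<^sub>m (m - 1)) $$ (x, q))"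
        using n by (intro member_le_sum) auto
      also have "\<dots> = (N * N ^\<^sub>m (m - 1)) $$ (p, q)"
        using N n by (simp add: mat_mult_index_sum[of _ n] del: index_mult_mat)
      also have "N * N ^\<^sub>m (m - 1) = N ^\<^sub>m m"
        using pow_mat_add[OF N, of 1 "m - 1"] \<open>m \<noteq> 0\<close> N by simp
      finally have "0 < (N ^\<^sub>m (card S - 1)) $$ (p, q)" by (simp flip: Suc.hyps(2))
      then show ?thesis using p *(2) by (auto simp: S'_def)
    qed
  qed simp
qed

section \<open>Weighted chains of coordinates\<close>

definition coord_le :: "nat \<times> nat \<Rightarrow> nat \<times> nat \<Rightarrow> bool" where
  "coord_le u v \<longleftrightarrow> fst u \<le> fst v \<and> snd v \<le> snd u"

text \<open>On the coordinates of an index this is the size of the block that contains it.\<close>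

definition coord_size :: "nat \<times> nat \<Rightarrow> nat" where
  "coord_size u = fst u + snd u + 1"

lemma coord_le_refl: "coord_le u u"
  by (simp add: coord_le_def)

lemma coord_le_trans: "coord_le u v \<Longrightarrow> coord_le v z \<Longrightarrow> coord_le u z"
  by (auto simp: coord_le_def)

text \<open>To be applied with \<open>w j\<close> the number of blocks of size \<open>j\<close>,
  \<open>l\<close> the smallest size met by a comparable set, \<open>T\<close> the largest part, and
  \<open>K\<close> the largest \<open>w j + w (Suc j)\<close> between them. Integer weights avoid
  truncated subtraction in the potential.\<close>

context
  fixes w :: "nat \<Rightarrow> int" and T l :: nat and K :: int
  assumes w_nonneg: "\<And>j. 0 \<le> w j"
    and K_bound: "\<And>j. l \<le> j \<Longrightarrow> j \<le> T \<Longrightarrow> w j + w (Suc j) \<le> K"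
begin

text \<open>View a chain as part of a lattice path from \<open>(0, T - 1)\<close> to \<open>(T - 1, 0)\<close>, whose steps change the size by
  one. Adding the weights of the two ends of every step counts the inner points twice. Every step
  contributes at most \<open>K\<close>, and a path that descends from size \<open>T\<close> to size \<open>s\<close> loses
  \<open>K - w j - w (j + 1)\<close> at least once for every \<open>j\<close> between \<open>s\<close> and \<open>T\<close>.\<close>

definition chain_potential :: "nat \<times> nat \<Rightarrow> int" where
  "chain_potential v = (int (fst v) + int T - 1 - int (snd v)) * K
     - (\<Sum>j = coord_size v..<T. K - w j - w (Suc j))"

text \<open>If the size drops, the gain minus the losses is at least the sum of the weights at both
  ends of each unit drop, and these include the two wanted ones. Otherwise nothing is lost: a single
  unit step joins sizes \<open>s\<close> and \<open>Suc s\<close>, whose weights sum to at most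
  \<open>K\<close>, and a longer move gains at least \<open>2 * K\<close>.\<close>

lemma chain_potential_step:
  assumes le: "coord_le u v" and neq: "u \<noteq> v"
    and u: "l \<le> coord_size u" "coord_size u \<le> T"
    and v: "l \<le> coord_size v" "coord_size v \<le> T"
  shows "w (coord_size u) + w (coord_size v) \<le> chain_potential v - chain_potential u"
proof -
  obtain x y x' y' where uv: "u = (x, y)" "v = (x', y')" by (metis surj_pair)
  define s where "s = coord_size u"
  define s' where "s' = coord_size v"
  \<comment> \<open>The number of unit steps on a lattice path from \<open>u\<close> to
    \<open>v\<close>.\<close>
  define \<delta> where "\<delta> = int x' - int x + (int y - int y')"
  let ?f = "\<lambda>j. K - w j - w (Suc j)"
  have le': "x \<le> x'" "y' \<le> y" using le uv by (auto simp: coord_le_def)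
  have s: "s = x + y + 1" "s' = x' + y' + 1" by (simp_all add: s_def s'_def uv coord_size_def)
  have K: "w s \<le> K" "w s' \<le> K" "0 \<le> K"
    using K_bound[of s] K_bound[of s'] w_nonneg[of s] w_nonneg[of "Suc s"] w_nonneg[of "Suc s'"] u v
    unfolding s_def s'_def by linarith+
  have diff: "chain_potential v - chain_potential u
      = \<delta> * K - (\<Sum>j = s'..<T. ?f j) + (\<Sum>j = s..<T. ?f j)"
    unfolding chain_potential_def s_def[symmetric] s'_def[symmetric] \<delta>_def
    by (simp add: uv algebra_simps)
  show ?thesis
  proof (cases "s' < s")
    case True
    have "(\<Sum>j = s'..<T. ?f j) = (\<Sum>j = s'..<s. ?f j) + (\<Sum>j = s..<T. ?f j)"
      using True u by (intro sum.atLeastLessThan_concat[symmetric]) (auto simp: s_def)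
    moreover have "(\<Sum>j = s'..<s. ?f j) = (int s - int s') * K
        - (\<Sum>j = s'..<s. w j) - (\<Sum>j = s'..<s. w (Suc j))"
      using True by (simp add: sum_subtractf of_nat_diff)
    moreover have "w s' \<le> (\<Sum>j = s'..<s. w j)"
      using True w_nonneg by (intro member_le_sum) auto
    \<comment> \<open>The size \<open>s\<close> lies just outside the summation range and appears as
      \<open>Suc j\<close> for \<open>j = s - 1\<close>.\<close>
    moreover have "w (Suc (s - 1)) \<le> (\<Sum>j = s'..<s. w (Suc j))"
      using True w_nonneg by (intro member_le_sum[where f = "\<lambda>j. w (Suc j)"]) auto
    moreover have "(int s - int s') * K \<le> \<delta> * K"
      using K le' by (intro mult_right_mono) (auto simp: \<delta>_def s)
    ultimately show ?thesis
      using diff True unfolding s_def[symmetric] s'_def[symmetric] by simp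
  next
    case False
    have "(\<Sum>j = s..<T. ?f j) = (\<Sum>j = s..<s'. ?f j) + (\<Sum>j = s'..<T. ?f j)"
      using False v by (intro sum.atLeastLessThan_concat[symmetric]) (auto simp: s'_def)
    moreover have "0 \<le> (\<Sum>j = s..<s'. ?f j)"
    proof (intro sum_nonneg)
      fix j assume "j \<in> {s..<s'}"
      then show "0 \<le> ?f j" using K_bound[of j] u v by (auto simp: s_def s'_def)
    qed
    ultimately have D: "\<delta> * K \<le> chain_potential v - chain_potential u"
      using diff by simp
    have "\<delta> \<ge> 1" using neq le' by (auto simp: uv \<delta>_def)
    have "w s + w s' \<le> \<delta> * K"
    proof (cases "\<delta> = 1")
      case True
      then have "s' = Suc s" using False le' unfolding \<delta>_def s by arith
      then show ?thesis using True K_bound[of s] u by (simp add: s_def)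
    next
      case False
      then have "2 * K \<le> \<delta> * K" using K \<open>\<delta> \<ge> 1\<close> by (intro mult_right_mono) auto
      then show ?thesis using K by linarith
    qed
    then show ?thesis using D by (simp add: s_def s'_def)
  qed
qed

text \<open>Removing the greatest point \<open>v\<close> lowers the left side by twice its weight,
  which the potential step from the next point covers. A lone point is compared with the start
  \<open>(0, T - 1)\<close>, which has potential 0.\<close>

lemma chain_weight_below_max:
  assumes "finite C" "v \<in> C" "\<And>u. u \<in> C \<Longrightarrow> coord_le u v"
    and "\<And>u. u \<in> C \<Longrightarrow> l \<le> coord_size u \<and> coord_size u \<le> T"
    and "\<And>u z. u \<in> C \<Longrightarrow> z \<in> C \<Longrightarrow> coord_le u z \<or> coord_le z u"
  shows "2 * (\<Sum>u\<in>C. w (coord_size u)) \<le> w T + w (coord_size v) + chain_potential v"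
  using assms
proof (induction "card C" arbitrary: C v)
  case (Suc m)
  define C' where "C' = C - {v}"
  have card: "m = card C'" and fin: "finite C'"
    using Suc.hyps(2) Suc.prems(1,2) by (simp_all add: C'_def flip: Suc.hyps(2))
  have sum: "(\<Sum>u\<in>C. w (coord_size u)) = w (coord_size v) + (\<Sum>u\<in>C'. w (coord_size u))"
    unfolding C'_def using Suc.prems(1,2) by (rule sum.remove)
  show ?case
  proof (cases "C' = {}")
    case True
    have "w (coord_size v) \<le> w T + chain_potential v"
    proof (cases "v = (0, T - 1)")
      case True
      then show ?thesis using Suc.prems(4)[OF Suc.prems(2)]
        by (simp add: chain_potential_def coord_size_def)
    next
      case False
      \<comment> \<open>Sizes are positive, so \<open>T\<close> is positive and \<open>T - 1\<close>
        is a true predecessor.\<close>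
      have T: "coord_size (0, T - 1) = T" "int (T - 1) = int T - 1"
        using Suc.prems(4)[OF Suc.prems(2)] by (auto simp: coord_size_def)
      have "coord_le (0, T - 1) v"
        using Suc.prems(4)[OF Suc.prems(2)] by (auto simp: coord_le_def coord_size_def)
      then have "w T + w (coord_size v) \<le> chain_potential v - chain_potential (0, T - 1)"
        using chain_potential_step[of "(0, T - 1)" v] False Suc.prems(4)[OF Suc.prems(2)] T by auto
      moreover have "chain_potential (0, T - 1) = 0"
        unfolding chain_potential_def T(1) using T(2) by simp
      ultimately show ?thesis using w_nonneg[of T] by linarith
    qed
    then show ?thesis using sum True by simp
  next
    case False
    have "\<exists>z\<in>C'. \<forall>u\<in>C'. coord_le u z"
    proof -
      have "\<And>u z. u \<in> C' \<Longrightarrow> z \<in> C' \<Longrightarrow> coord_le u z \<or> coord_le z u"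
        using Suc.prems(5) by (auto simp: C'_def)
      with fin False show ?thesis
      proof (induction C' rule: finite_ne_induct)
        case (insert y F)
        then obtain z where "z \<in> F" "\<forall>u\<in>F. coord_le u z" by blast
        then show ?case using insert.prems[of z y] coord_le_trans coord_le_refl
          by (metis insert_iff)
      qed (simp add: coord_le_refl)
    qed
    then obtain z where z: "z \<in> C'" "\<forall>u\<in>C'. coord_le u z" by blast
    have "2 * (\<Sum>u\<in>C'. w (coord_size u)) \<le> w T + w (coord_size z) + chain_potential z"
      using Suc.prems z fin by (intro Suc.hyps(1)[OF card]) (auto simp: C'_def)
    moreover have "w (coord_size z) + w (coord_size v) \<le> chain_potential v - chain_potential z"
      using z Suc.prems by (intro chain_potential_step) (auto simp: C'_def)
    ultimately show ?thesis using sum by linarith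
  qed
qed auto

text \<open>Cut the chain at a point \<open>v\<close> of least size. Swapping coordinates reverses
  the order and keeps sizes, so \<open>chain_weight_below_max\<close> also bounds the part above
  \<open>v\<close>. In the sum of the potentials of \<open>v\<close> and of its mirror image the
  position cancels and only the size \<open>l\<close> remains.\<close>

lemma chain_weight_bound:
  assumes C: "finite C" "v \<in> C" and v: "coord_size v = l"
    and size: "\<And>u. u \<in> C \<Longrightarrow> l \<le> coord_size u \<and> coord_size u \<le> T"
    and chain: "\<And>u z. u \<in> C \<Longrightarrow> z \<in> C \<Longrightarrow> coord_le u z \<or> coord_le z u"
    and k: "l \<le> k" "k \<le> T" "w k + w (Suc k) = K"
  shows "(\<Sum>u\<in>C. w (coord_size u)) \<le>
    (int k - 1) * K + (\<Sum>j = k..T. w j) + (\<Sum>j = Suc k..T. w j)"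
proof -
  define C1 where "C1 = {u \<in> C. coord_le u v}"
  define C2 where "C2 = {u \<in> C. coord_le v u}"
  define E where "E = (int T - 1) * K"
  \<comment> \<open>Adds the bounds on the doubled weights of the two parts, which share the point
    \<open>v\<close> of weight \<open>s\<close>, and halves the result.\<close>
  have arith: "c \<le> t + e - z"
    if "2 * a \<le> t + s + e1" "2 * b' \<le> t + s + e2" "b' = b" "a + b = c + s"
      "e1 + e2 = 2 * (e - z)" for a b b' c e e1 e2 s t z :: int
    using that by presburger
  let ?f = "\<lambda>j. K - w j - w (Suc j)"
  have swap: "coord_size (prod.swap u) = coord_size u"
    "coord_le (prod.swap u) (prod.swap z) \<longleftrightarrow> coord_le z u" for u z
    by (auto simp: coord_size_def coord_le_def)
  have "2 * (\<Sum>u\<in>C1. w (coord_size u)) \<le> w T + w (coord_size v) + chain_potential v"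
    using C size chain by (intro chain_weight_below_max) (auto simp: C1_def coord_le_refl)
  moreover have "2 * (\<Sum>u\<in>prod.swap ` C2. w (coord_size u))
      \<le> w T + w (coord_size (prod.swap v)) + chain_potential (prod.swap v)"
  proof (rule chain_weight_below_max)
    show "finite (prod.swap ` C2)" "prod.swap v \<in> prod.swap ` C2"
      using C by (auto simp: C2_def coord_le_refl simp del: swap_simp)
    fix u z assume u: "u \<in> prod.swap ` C2"
    then obtain u' where u': "u' \<in> C2" "u = prod.swap u'" by blast
    then show "coord_le u (prod.swap v)" "l \<le> coord_size u \<and> coord_size u \<le> T"
      using size by (auto simp: swap C2_def simp del: swap_simp)
    assume "z \<in> prod.swap ` C2"
    then obtain z' where "z' \<in> C2" "z = prod.swap z'" by blast
    then show "coord_le u z \<or> coord_le z u"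
      using u' chain by (auto simp: swap C2_def simp del: swap_simp)
  qed
  moreover have "(\<Sum>u\<in>prod.swap ` C2. w (coord_size u)) = (\<Sum>u\<in>C2. w (coord_size u))"
    by (subst sum.reindex) (simp_all add: swap)
  moreover have "(\<Sum>u\<in>C1. w (coord_size u)) + (\<Sum>u\<in>C2. w (coord_size u))
      = (\<Sum>u\<in>C. w (coord_size u)) + w l"
  proof -
    have "C1 \<union> C2 = C" using chain[OF _ C(2)] by (auto simp: C1_def C2_def)
    moreover have "C1 \<inter> C2 = {v}"
      using C(2) by (auto simp: C1_def C2_def coord_le_def prod_eq_iff)
    ultimately show ?thesis
      using sum.union_inter[of C1 C2 "\<lambda>u. w (coord_size u)"] C(1) v by (simp add: C1_def C2_def)
  qed
  moreover have "chain_potential v + chain_potential (prod.swap v)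
      = 2 * (E - (\<Sum>j = l..<T. ?f j))"
    unfolding E_def chain_potential_def swap v by (simp add: algebra_simps)
  ultimately have "(\<Sum>u\<in>C. w (coord_size u)) \<le> w T + E - (\<Sum>j = l..<T. ?f j)"
    unfolding swap v by (rule arith)
  moreover have "(\<Sum>j = k..<T. ?f j) \<le> (\<Sum>j = l..<T. ?f j)"
  proof (intro sum_mono2)
    fix j assume "j \<in> {l..<T} - {k..<T}"
    then show "0 \<le> ?f j" using K_bound[of j] by auto
  qed (use k in auto)
  moreover have "(\<Sum>j = k..<T. ?f j) = (int T - int k) * K
      - (\<Sum>j = k..<T. w j) - (\<Sum>j = k..<T. w (Suc j))"
    using k by (simp add: sum_subtractf of_nat_diff)
  moreover have "(\<Sum>j = k..<T. w (Suc j)) = (\<Sum>j = Suc k..T. w j)"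
    unfolding atLeastLessThanSuc_atLeastAtMost[symmetric]
    by (rule sum.shift_bounds_Suc_ivl[symmetric])
  moreover have "(\<Sum>j = k..T. w j) = (\<Sum>j = k..<T. w j) + w T"
    using k by (simp flip: atLeastLessThanSuc_atLeastAtMost)
  ultimately show ?thesis by (simp add: E_def algebra_simps)
qed

end

section \<open>Comparable sets of indices\<close>

text \<open>The number of elements of the extremal comparable set for block sizes \<open>m\<close>
  and \<open>m - 1\<close>, see \<open>card_near_level\<close>. On parts it is \<open>2 * i\<close>
  plus the sum of the full run of parts \<open>m\<close> and \<open>m - 1\<close>, where
  \<open>i\<close> parts exceed \<open>m\<close>.\<close>

definition level_bound :: "nat list \<Rightarrow> nat \<Rightarrow> nat" where
  "level_bound ks m =
    2 * length (filter (\<lambda>k. m < k) ks) + sum_list (filter (\<lambda>k. k = m \<or> Suc k = m) ks)"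

lemma level_bound_mset:
  assumes "mset ks = mset ls"
  shows "level_bound ks m = level_bound ls m"
proof -
  have "mset (filter P ks) = mset (filter P ls)" for P using assms by simp
  then have "length (filter P ks) = length (filter P ls)"
    "sum_list (filter P ks) = sum_list (filter P ls)" for P
    by (metis size_mset, metis sum_mset_sum_list)
  then show ?thesis by (simp add: level_bound_def)
qed

lemma le_level_bound: "m \<in> set ks \<Longrightarrow> m \<le> level_bound ks m"
  unfolding level_bound_def
  using member_le_sum_list[of m "filter (\<lambda>k. k = m \<or> Suc k = m) ks"] by simp

lemma length_filter_greater_sum:
  assumes "\<forall>k\<in>set ks. k \<le> T"
  shows "length (filter (\<lambda>k. m < k) ks) = (\<Sum>j = Suc m..T. count_list ks j)"
  using assms
proof (induction ks)
  case (Cons k ks)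
  have "(\<Sum>j = Suc m..T. count_list (k # ks) j)
      = (\<Sum>j = Suc m..T. count_list ks j + (if k = j then 1 else 0))"
    by (intro sum.cong) auto
  then show ?case using Cons by (auto simp: sum.distrib)
qed simp

lemma sum_list_filter_level:
  "sum_list (filter (\<lambda>k. k = m \<or> Suc k = m) ks) = m * count_list ks m + (m - 1) * count_list ks (m - 1)"
proof (induction ks)
  case (Cons k ks)
  then show ?case by (cases m) auto
qed simp

lemma level_bound_counts:
  assumes "\<forall>k\<in>set ks. k \<le> T"
  shows "level_bound ks m = 2 * (\<Sum>j = Suc m..T. count_list ks j)
    + m * count_list ks m + (m - 1) * count_list ks (m - 1)"
  unfolding level_bound_def length_filter_greater_sum[OF assms] sum_list_filter_level by simp

lemma card_coord_fibre:
  "card {p. p < sum_list ks \<and> block_coords ks ! p = u} = count_list ks (coord_size u)"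
  using count_block_coords[of ks "fst u" "snd u"]
  by (simp add: count_list_eq_length_filter length_filter_conv_card coord_size_def eq_commute[of u])

text \<open>At most as many indices share a coordinate pair as there are blocks of its size, so
  \<open>S\<close> is no larger than the weight of the chain of its coordinates. The bound on this
  weight, taken at a \<open>k\<close> with \<open>w k + w (Suc k)\<close> maximal, equals
  \<open>level_bound ks (Suc k)\<close>, and it is at most \<open>level_bound ks k\<close> if no
  block has size \<open>Suc k\<close>.\<close>

lemma comparable_card_le_level_bound:
  assumes S: "S \<subseteq> {..<sum_list ks}" "S \<noteq> {}"
    and comp: "\<forall>p\<in>S. \<forall>q\<in>S. coord_le (block_coords ks ! p) (block_coords ks ! q)
      \<or> coord_le (block_coords ks ! q) (block_coords ks ! p)"
  shows "\<exists>m\<in>set ks. card S \<le> level_bound ks m"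
proof -
  define C where "C = (\<lambda>p. block_coords ks ! p) ` S"
  define w where "w j = int (count_list ks j)" for j
  define T where "T = Max (set ks)"
  have finS: "finite S" using S(1) finite_subset by blast
  have C: "finite C" "C \<noteq> {}" using finS S(2) by (auto simp: C_def)
  have size: "coord_size u \<in> set ks" if "u \<in> C" for u
  proof -
    have "u \<in> set (block_coords ks)" using that S(1) by (auto simp: C_def)
    then have "count_list (block_coords ks) u \<noteq> 0" by (simp add: count_list_0_iff)
    then have "count_list ks (coord_size u) \<noteq> 0"
      using count_block_coords[of ks "fst u" "snd u"] by (simp add: coord_size_def)
    then show ?thesis using count_notin by metis
  qed
  have T: "k \<le> T" if "k \<in> set ks" for k using that by (simp add: T_def)
  then have T0: "w (Suc T) = 0" unfolding w_def using count_notin Suc_n_not_le_n by (metis of_nat_0)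
  define l where "l = Min (coord_size ` C)"
  have "l \<in> coord_size ` C" unfolding l_def using C by (intro Min_in) auto
  then obtain v where v: "v \<in> C" "coord_size v = l" by blast
  have l: "l \<le> coord_size u" if "u \<in> C" for u unfolding l_def using that C by simp
  have "l \<le> T" using T size v by blast
  define K where "K = Max ((\<lambda>j. w j + w (Suc j)) ` {l..T})"
  have "K \<in> (\<lambda>j. w j + w (Suc j)) ` {l..T}"
    unfolding K_def using \<open>l \<le> T\<close> by (intro Max_in) auto
  then obtain k where k: "l \<le> k" "k \<le> T" "w k + w (Suc k) = K" by auto
  have K: "w j + w (Suc j) \<le> K" if "l \<le> j" "j \<le> T" for j
    unfolding K_def using that by (intro Max_ge) auto
  \<comment> \<open>Positivity of \<open>K\<close> will ensure that \<open>k\<close> or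
    \<open>Suc k\<close> is a block size.\<close>
  have "0 < w l" using size[OF v(1)] v(2) 
    by (simp add: w_def) (metis count_list_0_iff gr0I)
  then have "0 < K" using K[of l] \<open>l \<le> T\<close> by (simp add: w_def)
  have "card S = card (\<Union>u\<in>C. {p \<in> S. block_coords ks ! p = u})"
    by (intro arg_cong[where f = card]) (auto simp: C_def)
  also have "\<dots> \<le> (\<Sum>u\<in>C. card {p \<in> S. block_coords ks ! p = u})"
    using C(1) by (rule card_UN_le)
  also have "\<dots> \<le> (\<Sum>u\<in>C. count_list ks (coord_size u))"
    unfolding card_coord_fibre[symmetric] using S(1) by (intro sum_mono card_mono) auto
  finally have "int (card S) \<le> (\<Sum>u\<in>C. w (coord_size u))"
    unfolding w_def by (metis of_nat_le_iff of_nat_sum)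
  also have "\<dots> \<le> (int k - 1) * K + (\<Sum>j = k..T. w j) + (\<Sum>j = Suc k..T. w j)"
  proof (rule chain_weight_bound[where l = l])
    show "coord_le u z \<or> coord_le z u" if "u \<in> C" "z \<in> C" for u z
      using that comp by (auto simp: C_def)
  qed (use C v l K k T size in \<open>auto simp: w_def\<close>)
  finally have bound: "int (card S) \<le>
    (int k - 1) * (w k + w (Suc k)) + (\<Sum>j = k..T. w j) + (\<Sum>j = Suc k..T. w j)" using k by simp
  have split: "(\<Sum>j = i..T. w j) = w i + (\<Sum>j = Suc i..T. w j)" if "i \<le> T" for i
    using that by (rule sum.atLeast_Suc_atMost)
  have lb: "int (level_bound ks m) = 2 * (\<Sum>j = Suc m..T. w j) + int m * w m + int (m - 1) * w (m - 1)" for m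
    using T by (simp add: level_bound_counts[of ks T] w_def)
  show ?thesis
  proof (cases "w (Suc k) = 0")
    case True
    then have "k \<in> set ks" using k \<open>0 < K\<close> count_notin by (force simp: w_def)
    moreover have "int (card S) \<le> int (level_bound ks k)"
    proof -
      have "0 \<le> int (k - 1) * w (k - 1)" by (simp add: w_def)
      then show ?thesis
        using bound True unfolding lb split[OF k(2)] by (simp add: algebra_simps)
    qed
    ultimately show ?thesis by auto
  next
    case False
    then have "Suc k \<in> set ks" using count_notin by (force simp: w_def)
    then have "Suc k \<le> T" using T by blast
    have "int (card S) \<le> int (level_bound ks (Suc k))"
      using bound unfolding lb split[OF k(2)] split[OF \<open>Suc k \<le> T\<close>] by (simp add: algebra_simps)
    then show ?thesis using \<open>Suc k \<in> set ks\<close> by auto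
  qed
qed

section \<open>Comparable sets that attain the bound\<close>

definition near_level :: "nat \<Rightarrow> nat \<times> nat \<Rightarrow> bool" where
  "near_level m u \<longleftrightarrow> coord_size u = m \<or> Suc (coord_size u) = m
    \<or> m < coord_size u \<and> (fst u = 0 \<or> snd u = 0)"

text \<open>Of two incomparable points, one exceeds the other in both coordinates. It is not at an
  end of its block, so its size is at most \<open>m\<close>; the other size is smaller by at least 2
  and thus too small.\<close>

lemma near_level_comparable:
  assumes "near_level m u" "near_level m v"
  shows "coord_le u v \<or> coord_le v u"
proof (rule ccontr)
  assume "\<not> ?thesis"
  then have "fst u < fst v \<and> snd u < snd v \<or> fst v < fst u \<and> snd v < snd u"
    by (auto simp: coord_le_def)
  then show False using assms by (auto simp: near_level_def coord_size_def)
qed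

lemma card_near_level:
  assumes "0 < m"
  shows "card {p. p < sum_list ks \<and> near_level m (block_coords ks ! p)} = level_bound ks m"
proof -
  let ?P = "near_level m"
  have "length (filter ?P (block_coords ks)) = level_bound ks m"
  proof (induction ks)
    case (Cons k ks)
    have "length (filter ?P (map (\<lambda>i. (i, k - 1 - i)) [0..<k]))
        = card {i. i < k \<and> ?P (i, k - 1 - i)}"
      by (simp add: length_filter_conv_card cong: conj_cong)
    also have "{i. i < k \<and> ?P (i, k - 1 - i)}
        = (if k = m \<or> Suc k = m then {..<k} else if m < k then {0, k - 1} else {})"
      using assms by (auto simp: near_level_def coord_size_def)
    \<comment> \<open>Since \<open>0 < m\<close>, a block larger than \<open>m\<close> has two
      distinct ends.\<close>
    also have "card \<dots> = (if k = m \<or> Suc k = m then k else if m < k then 2 else 0)"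
      using assms by auto
    finally show ?case using Cons by (auto simp: level_bound_def)
  qed (simp add: level_bound_def)
  then show ?thesis by (simp add: length_filter_conv_card)
qed

section \<open>The maximum over runs of parts\<close>

text \<open>In a decreasing list the entries with a property inherited by larger numbers form a
  prefix.\<close>

lemma sorted_filter_append:
  assumes "sorted_wrt (\<ge>) xs" and "\<And>x y :: nat. P x \<Longrightarrow> x \<le> y \<Longrightarrow> P y"
  shows "filter P xs @ filter (\<lambda>x. \<not> P x) xs = xs"
  using assms(1)
proof (induction xs)
  case (Cons x xs)
  show ?case
  proof (cases "P x")
    case False
    then have "\<forall>y\<in>set xs. \<not> P y" using Cons.prems assms(2) by auto
    then have "filter P xs = []" "filter (\<lambda>x. \<not> P x) xs = xs" by (auto simp: filter_empty_conv)
    then show ?thesis using False by simp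
  qed (use Cons in simp)
qed simp

lemma sum_part:
  assumes "i + r \<le> length \<mu>"
  shows "(\<Sum>j = i + 1..i + r. part \<mu> j) = sum_list (take r (drop i \<mu>))"
proof -
  have "(\<Sum>j = i + 1..i + r. part \<mu> j) = (\<Sum>j = 0..<r. \<mu> ! (i + j))"
    by (rule sum.reindex_bij_witness[of _ "\<lambda>j. Suc (i + j)" "\<lambda>j. j - Suc i"])
      (auto simp: part_def)
  then show ?thesis using assms by (simp add: sum_list_sum_nth)
qed

text \<open>Let \<open>m\<close> be part \<open>i + 1\<close>. As parts \<open>i\<close> and
  \<open>i + 1\<close> differ, the first \<open>i\<close> parts are larger than \<open>m\<close>,
  and the run consists of parts \<open>m\<close> and \<open>m - 1\<close>, so its value is at most
  \<open>level_bound \<mu> m\<close>. The full run attains this.\<close>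

lemma Max_path_lengths:
  assumes sorted: "sorted_wrt (\<ge>) \<mu>" and ne: "\<mu> \<noteq> []"
  shows "Max {2 * i + (\<Sum>j = i + 1..i + r. part \<mu> j) | i r.
      i < length \<mu> \<and> 1 \<le> r \<and> i + r \<le> length \<mu> \<and>
      int (part \<mu> (i + 1)) - int (part \<mu> (i + r)) \<le> 1 \<and>
      part \<mu> i \<noteq> part \<mu> (i + 1)} = Max (level_bound \<mu> ` set \<mu>)"
    (is "Max ?V = _")
proof -
  have mono: "\<mu> ! j \<le> \<mu> ! i" if "i \<le> j" "j < length \<mu>" for i j
    using that sorted by (cases "i = j") (auto simp: sorted_wrt_iff_nth_less)
  have le: "\<exists>m\<in>set \<mu>. x \<le> level_bound \<mu> m" if "x \<in> ?V" for x
  proof -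
    from that obtain i r where ir: "x = 2 * i + (\<Sum>j = i + 1..i + r. part \<mu> j)"
      "i < length \<mu>" "1 \<le> r" "i + r \<le> length \<mu>"
      "int (part \<mu> (i + 1)) - int (part \<mu> (i + r)) \<le> 1" "part \<mu> i \<noteq> part \<mu> (i + 1)" by blast
    \<comment> \<open>List positions start at 0, so this is part \<open>i + 1\<close>.\<close>
    define m where "m = \<mu> ! i"
    have gt: "m < \<mu> ! j" if "j < i" for j
    proof -
      have "\<mu> ! (i - 1) \<noteq> m" using ir(6) that by (simp add: m_def part_def)
      moreover have "m \<le> \<mu> ! (i - 1)" unfolding m_def using ir(2) by (intro mono) auto
      moreover have "\<mu> ! (i - 1) \<le> \<mu> ! j" using that ir(2) by (intro mono) auto
      ultimately show ?thesis by linarith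
    qed
    have near: "y = m \<or> Suc y = m" if y: "y \<in> set (take r (drop i \<mu>))" for y
    proof -
      obtain j where j: "j < r" "y = \<mu> ! (i + j)"
        using y ir(4) by (auto simp: in_set_conv_nth)
      have "y \<le> m" unfolding m_def j using j ir(4) by (intro mono) auto
      moreover have "\<mu> ! (i + r - 1) \<le> y" unfolding j using j ir(4) by (intro mono) auto
      moreover have "m \<le> Suc (\<mu> ! (i + r - 1))" using ir(3,5) by (simp add: part_def m_def)
      ultimately show ?thesis by linarith
    qed
    have filter: "filter P \<mu> = filter P (take i \<mu>) @ filter P (take r (drop i \<mu>))
        @ filter P (drop r (drop i \<mu>))" for P
      by (metis filter_append append_take_drop_id)
    have "filter (\<lambda>k. m < k) (take i \<mu>) = take i \<mu>"
      using gt ir(2) by (auto simp: filter_id_conv in_set_conv_nth)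
    then have "i \<le> length (filter (\<lambda>k. m < k) \<mu>)"
      using filter[of "\<lambda>k. m < k"] ir(2) by simp
    moreover have "filter (\<lambda>k. k = m \<or> Suc k = m) (take r (drop i \<mu>)) = take r (drop i \<mu>)"
      using near by (simp add: filter_id_conv)
    then have "sum_list (take r (drop i \<mu>)) \<le> sum_list (filter (\<lambda>k. k = m \<or> Suc k = m) \<mu>)"
      using filter[of "\<lambda>k. k = m \<or> Suc k = m"] by simp
    ultimately have "x \<le> level_bound \<mu> m"
      unfolding ir(1) sum_part[OF ir(4)] level_bound_def by linarith
    then show ?thesis using ir(2) by (auto simp: m_def)
  qed
  have mem: "level_bound \<mu> m \<in> ?V" if m: "m \<in> set \<mu>" for m
  proof -
    \<comment> \<open>The list splits into the parts above \<open>m\<close>, the full run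
      \<open>H\<close> and the rest; the witnesses will be \<open>i = length G\<close> and
      \<open>r = length H\<close>.\<close>
    define G where "G = filter (\<lambda>k. m < k) \<mu>"
    define H where "H = filter (\<lambda>k. k = m \<or> Suc k = m) \<mu>"
    define D where "D = filter (\<lambda>k. \<not> m - 1 \<le> k) \<mu>"
    have 1: "G @ filter (\<lambda>k. \<not> m < k) \<mu> = \<mu>"
      unfolding G_def using sorted by (rule sorted_filter_append) auto
    have "filter (\<lambda>k. m - 1 \<le> k) (filter (\<lambda>k. \<not> m < k) \<mu>)
        @ filter (\<lambda>k. \<not> m - 1 \<le> k) (filter (\<lambda>k. \<not> m < k) \<mu>) = filter (\<lambda>k. \<not> m < k) \<mu>"
      using sorted by (intro sorted_filter_append sorted_wrt_filter) auto
    moreover have "filter (\<lambda>k. m - 1 \<le> k) (filter (\<lambda>k. \<not> m < k) \<mu>) = H"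
      unfolding H_def filter_filter by (intro filter_cong) auto
    moreover have "filter (\<lambda>k. \<not> m - 1 \<le> k) (filter (\<lambda>k. \<not> m < k) \<mu>) = D"
      unfolding D_def filter_filter by (intro filter_cong) auto
    ultimately have \<mu>: "\<mu> = G @ H @ D" using 1 by simp
    have mH: "m \<in> set H" using m by (simp add: H_def)
    then have "H \<noteq> []" by auto
    have Hset: "k = m \<or> Suc k = m" if "k \<in> set H" for k using that by (auto simp: H_def)
    have "sorted_wrt (\<ge>) H" unfolding H_def using sorted by (rule sorted_wrt_filter)
    then have "m \<le> H ! 0" using mH
      by (cases H) auto
    then have "H ! 0 = m" using Hset[of "H ! 0"] \<open>H \<noteq> []\<close> by force
    then have first: "\<mu> ! length G = m" using \<open>H \<noteq> []\<close> by (subst \<mu>) (simp add: nth_append)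
    have last: "part \<mu> (length G + length H) = H ! (length H - 1)"
    proof -
      have "\<mu> ! (length G + length H - 1) = (G @ H @ D) ! (length G + (length H - 1))"
        using \<open>H \<noteq> []\<close> \<mu> by (cases H) auto
      then show ?thesis using \<open>H \<noteq> []\<close> unfolding part_def
        by (simp only: nth_append_length_plus) (simp add: nth_append)
    qed
    have "part \<mu> (length G) \<noteq> part \<mu> (length G + 1)"
    proof (cases "G = []")
      \<comment> \<open>For \<open>i = 0\<close> the two parts differ by the convention for part
        0.\<close>
      case True
      then show ?thesis by (simp add: part_def)
    next
      case False
      then have "\<mu> ! (length G - 1) = G ! (length G - 1)" by (subst \<mu>) (simp add: nth_append)
      moreover have "G ! (length G - 1) \<in> set G" using False by simp
      ultimately have "m < \<mu> ! (length G - 1)" by (simp add: G_def)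
      then show ?thesis using False first by (simp add: part_def)
    qed
    moreover have "length G + length H \<le> length \<mu>" "length G < length \<mu>"
      using \<open>H \<noteq> []\<close> by (subst \<mu>, simp)+
    moreover have "int (part \<mu> (length G + 1)) - int (part \<mu> (length G + length H)) \<le> 1"
      unfolding last using Hset[of "H ! (length H - 1)"] \<open>H \<noteq> []\<close> first by (auto simp: part_def)
    moreover have "take (length H) (drop (length G) \<mu>) = H" by (subst \<mu>) simp
    then have "level_bound \<mu> m = 2 * length G + (\<Sum>j = length G + 1..length G + length H. part \<mu> j)"
      using sum_part[of "length G" "length H" \<mu>] \<open>length G + length H \<le> length \<mu>\<close>
      by (simp add: level_bound_def G_def H_def)
    moreover have "1 \<le> length H" using \<open>H \<noteq> []\<close> by (cases H) auto
    ultimately show ?thesis by blast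
  qed
  have le_Max: "x \<le> Max (level_bound \<mu> ` set \<mu>)" if "x \<in> ?V" for x
    using le[OF that] by (metis Max_ge finite_imageI finite_set imageI le_trans)
  then have fin: "finite ?V"
    by (intro finite_subset[of ?V "{..Max (level_bound \<mu> ` set \<mu>)}"] subsetI)
      (simp_all only: atMost_iff finite_atMost)
  show ?thesis
  proof (rule antisym)
    show "Max ?V \<le> Max (level_bound \<mu> ` set \<mu>)"
    proof (rule Max.boundedI[OF fin])
      show "?V \<noteq> {}" using mem[of "hd \<mu>"] ne by (metis empty_iff hd_in_set)
    qed (rule le_Max)
    show "Max (level_bound \<mu> ` set \<mu>) \<le> Max ?V"
    proof (rule Max.boundedI)
      fix x assume "x \<in> level_bound \<mu> ` set \<mu>"
      then show "x \<le> Max ?V" using mem fin by (metis (lifting) Max_ge imageE)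
    qed (use ne in auto)
  qed
qed

section \<open>The commutator of a nilpotent Jordan matrix\<close>

context
  fixes ks :: "nat list" and J :: "'a::semiring_1 mat" and n :: nat
  defines "J \<equiv> jordan_matrix (map (\<lambda>k. (k, 0)) ks)" and "n \<equiv> sum_list ks"
begin

lemma jordan_carrier: "J \<in> carrier_mat n n"
proof -
  have "sum_list (map (fst \<circ> (\<lambda>k. (k, 0::'a))) ks) = sum_list ks" by (simp add: comp_def)
  then show ?thesis unfolding J_def n_def by (intro carrier_matI) simp_all
qed

lemma jordan_mult_left:
  assumes A: "A \<in> carrier_mat n n" and p: "p < n" and q: "q < n"
  shows "(J * A) $$ (p, q) = (if snd (block_coords ks ! p) > 0 then A $$ (Suc p, q) else 0)"
proof -
  have "(J * A) $$ (p, q)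
      = (\<Sum>x<n. if x = Suc p \<and> snd (block_coords ks ! p) > 0 then A $$ (x, q) else 0)"
    unfolding mat_mult_index_sum[OF jordan_carrier A p q]
    using p by (intro sum.cong) (auto simp: J_def n_def jordan_matrix_coords)
  then show ?thesis using block_coords_Suc(1)[of p ks] p by (auto simp: n_def)
qed

lemma jordan_mult_right:
  assumes A: "A \<in> carrier_mat n n" and p: "p < n" and q: "q < n"
  shows "(A * J) $$ (p, q) = (if fst (block_coords ks ! q) > 0 then A $$ (p, q - 1) else 0)"
proof -
  have "(A * J) $$ (p, q)
      = (\<Sum>x<n. if q = Suc x \<and> snd (block_coords ks ! x) > 0 then A $$ (p, x) else 0)"
    unfolding mat_mult_index_sum[OF A jordan_carrier p q]
    using q by (intro sum.cong) (auto simp: J_def n_def jordan_matrix_coords)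
  \<comment> \<open>The only candidate for \<open>x\<close> is \<open>q - 1\<close>. Index 0 has
    first coordinate 0, so the truncated predecessor is never read.\<close>
  also have "\<dots> = (\<Sum>x<n. if x = q - 1 \<and> fst (block_coords ks ! q) > 0 then A $$ (p, x) else 0)"
  proof (intro sum.cong refl)
    fix x
    have "q = Suc x \<and> snd (block_coords ks ! x) > 0 \<longleftrightarrow> x = q - 1 \<and> fst (block_coords ks ! q) > 0"
      using block_coords_Suc(2)[of x ks] block_coords_predE[of q ks] q
      by (metis Suc_lessD diff_Suc_1 n_def zero_less_Suc)
    then show "(if q = Suc x \<and> snd (block_coords ks ! x) > 0 then A $$ (p, x) else 0)
      = (if x = q - 1 \<and> fst (block_coords ks ! q) > 0 then A $$ (p, x) else 0)" by simp
  qed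
  finally show ?thesis using q by auto
qed

text \<open>Compare the entries of \<open>A * J\<close> and \<open>J * A\<close>: a nonzero entry
  whose row is not first in its block forces a nonzero entry one row up and one column left, inside
  the same blocks. Repeating this until the row is first compares the first coordinates; moving down
  and right until the column is last compares the second ones.\<close>

lemma jordan_commute_support:
  assumes A: "A \<in> carrier_mat n n" and comm: "A * J = J * A"
    and "p < n" "q < n" "A $$ (p, q) \<noteq> 0"
  shows "coord_le (block_coords ks ! p) (block_coords ks ! q)"
proof -
  have eq: "(if snd (block_coords ks ! p) > 0 then A $$ (Suc p, q) else 0)
      = (if fst (block_coords ks ! q) > 0 then A $$ (p, q - 1) else 0)" if "p < n" "q < n" for p q
    using jordan_mult_left[OF A that] jordan_mult_right[OF A that] comm by simp
  have "fst (block_coords ks ! p) \<le> fst (block_coords ks ! q)"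
    using assms(3-)
  proof (induction "fst (block_coords ks ! p)" arbitrary: p q)
    case (Suc a)
    obtain p' where p': "p = Suc p'" "snd (block_coords ks ! p') > 0"
      "fst (block_coords ks ! p) = Suc (fst (block_coords ks ! p'))"
      using block_coords_predE[of p ks] Suc.hyps(2) Suc.prems(1) unfolding n_def by auto
    have *: "fst (block_coords ks ! q) > 0" "A $$ (p', q - 1) \<noteq> 0"
      using eq[of p' q] p' Suc.prems by (auto split: if_splits)
    obtain q' where q': "q = Suc q'"
      "fst (block_coords ks ! q) = Suc (fst (block_coords ks ! q'))"
      using block_coords_predE[of q ks] *(1) Suc.prems(2) unfolding n_def by auto
    have "fst (block_coords ks ! p') \<le> fst (block_coords ks ! q')"
      using Suc.hyps(2) Suc.prems p' q' * by (intro Suc.hyps(1)) auto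
    then show ?case using p' q' by simp
  qed simp
  moreover have "snd (block_coords ks ! q) \<le> snd (block_coords ks ! p)"
    using assms(3-)
  proof (induction "snd (block_coords ks ! q)" arbitrary: p q)
    case (Suc b)
    then have r: "snd (block_coords ks ! q) > 0" by simp
    note q = block_coords_Suc[OF Suc.prems(2)[unfolded n_def] r]
    have *: "snd (block_coords ks ! p) > 0 \<and> A $$ (Suc p, Suc q) \<noteq> 0"
      using eq[of p "Suc q"] q Suc.prems by (auto simp: n_def split: if_splits)
    then have p: "Suc p < n" "snd (block_coords ks ! p) = Suc (snd (block_coords ks ! Suc p))"
      using block_coords_Suc[of p ks] Suc.prems(1) by (auto simp: n_def)
    have "snd (block_coords ks ! Suc q) \<le> snd (block_coords ks ! Suc p)"
      using Suc.hyps(2) q p * by (intro Suc.hyps(1)) (auto simp: n_def)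
    then show ?case using p q by simp
  qed simp
  ultimately show ?thesis by (simp add: coord_le_def)
qed

text \<open>Different blocks of the same size share their coordinates. Breaking these ties by index
  turns the preorder into a strict order that relates any two distinct comparable indices.\<close>

definition coord_less :: "nat \<Rightarrow> nat \<Rightarrow> bool" where
  "coord_less p q \<longleftrightarrow> coord_le (block_coords ks ! p) (block_coords ks ! q) \<and>
    (block_coords ks ! p \<noteq> block_coords ks ! q \<or> p < q)"

text \<open>The entry type is left open: over the naturals the powers count paths, while over the
  field the matrix commutes with \<open>J\<close>.\<close>

definition path_mat :: "'b::semiring_1 mat" where
  "path_mat = mat n n (\<lambda>(p, q). if coord_less p q then 1 else 0)"

lemma path_mat_carrier: "path_mat \<in> carrier_mat n n"
  by (simp add: path_mat_def)

lemma coord_less_trans: "coord_less p q \<Longrightarrow> coord_less q x \<Longrightarrow> coord_less p x"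
  by (auto simp: coord_less_def coord_le_def prod_eq_iff)

text \<open>\<open>Suc p\<close> compares with \<open>q\<close> as \<open>p\<close> does with
  \<open>q - 1\<close>, since inside the blocks both coordinates shift equally and ties are kept.
  Where only one of the two neighbours stays in its block, the coordinates exclude the
  relation.\<close>

lemma path_mat_commute: "(path_mat :: 'a mat) * J = J * path_mat"
proof (rule eq_matI)
  fix p q assume "p < dim_row (J * path_mat)" "q < dim_col (J * path_mat)"
  then have pq: "p < n" "q < n" using jordan_carrier by (auto simp: path_mat_def)
  let ?c = "\<lambda>p. block_coords ks ! p"
  have "(if snd (?c p) > 0 then path_mat $$ (Suc p, q) else 0)
      = (if fst (?c q) > 0 then path_mat $$ (p, q - 1) else (0::'a))"
  proof (cases "snd (?c p) > 0")
    case p: True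
    note p' = block_coords_Suc[OF pq(1)[unfolded n_def] p]
    show ?thesis
    proof (cases "fst (?c q) > 0")
      case q: True
      then obtain q' where q': "q = Suc q'" "snd (?c q') > 0" "fst (?c q) = Suc (fst (?c q'))"
        using block_coords_predE[of q ks] pq(2) unfolding n_def by auto
      then have "snd (?c q') = Suc (snd (?c q))"
        using block_coords_Suc(3)[of q' ks] pq(2) by (simp add: n_def)
      then have "coord_less (Suc p) q \<longleftrightarrow> coord_less p q'"
        using p' q' by (auto simp: coord_less_def coord_le_def prod_eq_iff)
      then show ?thesis using p p' q q' pq by (simp add: path_mat_def n_def)
    next
      case q: False
      then have "\<not> coord_less (Suc p) q" using p' by (auto simp: coord_less_def coord_le_def)
      then show ?thesis using q p' pq by (simp add: path_mat_def n_def)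
    qed
  next
    case p: False
    have "\<not> coord_less p (q - 1)" if q: "fst (?c q) > 0"
    proof -
      obtain q' where q': "q = Suc q'" "snd (?c q') > 0"
        using block_coords_predE[of q ks] q pq(2) unfolding n_def by auto
      then show ?thesis using p q' by (simp add: coord_less_def coord_le_def)
    qed
    then show ?thesis using p pq by (simp add: path_mat_def)
  qed
  then show "(path_mat * J) $$ (p, q) = (J * path_mat) $$ (p, q)"
    unfolding jordan_mult_left[OF path_mat_carrier pq] jordan_mult_right[OF path_mat_carrier pq]
    by (rule sym)
qed (use jordan_carrier in \<open>auto simp: path_mat_def\<close>)

lemma path_mat_nilpotent: "\<exists>k. (path_mat :: 'b::semiring_1 mat) ^\<^sub>m k = 0\<^sub>m n n"
proof -
  \<comment> \<open>a linear extension of \<open>coord_less\<close>\<close>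
  define \<phi> where "\<phi> p = (fst (block_coords ks ! p) + (n - snd (block_coords ks ! p))) * n + p" for p
  \<comment> \<open>Keeps the subtraction in \<open>\<phi>\<close> from being truncated.\<close>
  have small: "fst (block_coords ks ! p) \<le> n \<and> snd (block_coords ks ! p) \<le> n" if "p < n" for p
  proof -
    have "fst u \<le> sum_list ls \<and> snd u \<le> sum_list ls" if "u \<in> set (block_coords ls)" for u ls
      using that by (induction ls) auto
    then show ?thesis using that by (simp add: n_def)
  qed
  have incr: "\<phi> p < \<phi> q" if pq: "p < n" "q < n" "coord_less p q" for p q
  proof (cases "block_coords ks ! p = block_coords ks ! q")
    case True
    then show ?thesis using pq by (simp add: \<phi>_def coord_less_def)
  next
    case False
    have "fst (block_coords ks ! p) + (n - snd (block_coords ks ! p)) + 1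
      \<le> fst (block_coords ks ! q) + (n - snd (block_coords ks ! q))"
      using pq(3) False small[OF pq(1)] small[OF pq(2)]
      by (auto simp: coord_less_def coord_le_def prod_eq_iff)
    then have "(fst (block_coords ks ! p) + (n - snd (block_coords ks ! p)) + 1) * n
      \<le> (fst (block_coords ks ! q) + (n - snd (block_coords ks ! q))) * n" by (rule mult_le_mono1)
    then show ?thesis using pq(1) unfolding \<phi>_def by (simp add: algebra_simps)
  qed
  define k where "k = Suc (Max (\<phi> ` {..<n}))"
  have "(path_mat :: 'b mat) ^\<^sub>m k = 0\<^sub>m n n"
  proof (rule eq_matI)
    fix p q assume "p < dim_row (0\<^sub>m n n :: 'b mat)" "q < dim_col (0\<^sub>m n n :: 'b mat)"
    then have pq: "p < n" "q < n" by auto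
    have "\<phi> q < k" unfolding k_def using pq(2) by (simp add: less_Suc_eq_le)
    then have "\<not> \<phi> p + k \<le> \<phi> q" by simp
    then have "((path_mat :: 'b mat) ^\<^sub>m k) $$ (p, q) = 0"
      using mat_pow_nonzero_potential[of "path_mat :: 'b mat" n \<phi> p q k] pq incr
      by (force simp: path_mat_def split: if_splits)
    then show "((path_mat :: 'b mat) ^\<^sub>m k) $$ (p, q) = 0\<^sub>m n n $$ (p, q)" using pq by simp
  qed (use path_mat_carrier in auto)
  then show ?thesis ..
qed

text \<open>The indices near level \<open>m\<close> are pairwise comparable and number
  \<open>level_bound ks m\<close>, so they form a path with one step less. A positive number of
  paths stays nonzero in characteristic 0.\<close>

lemma path_mat_pow_nonzero:
  assumes m: "m \<in> set ks" "0 < m"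
  shows "(path_mat :: 'b::{semiring_1, semiring_char_0} mat) ^\<^sub>m (level_bound ks m - 1) \<noteq> 0\<^sub>m n n"
proof -
  let ?c = "\<lambda>p. block_coords ks ! p"
  let ?N = "path_mat :: nat mat"
  define S where "S = {p. p < n \<and> near_level m (?c p)}"
  have card: "card S = level_bound ks m"
    unfolding S_def n_def using m(2) by (rule card_near_level)
  have "card S \<noteq> 0" using le_level_bound[OF m(1)] m(2) card by simp
  then have "S \<noteq> {}" by auto
  have "\<exists>p\<in>S. \<exists>q\<in>S. (\<forall>x\<in>S. p = x \<or> coord_less p x) \<and> (?N ^\<^sub>m (card S - 1)) $$ (p, q) > 0"
  proof (rule nat_mat_pow_pos_chain[OF path_mat_carrier])
    show "S \<subseteq> {..<n}" by (auto simp: S_def)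
    show "?N $$ (p, q) > 0" if "p \<in> S" "q \<in> S" "coord_less p q" for p q
      using that by (auto simp: path_mat_def S_def)
    show "\<forall>p\<in>S. \<forall>q\<in>S. p = q \<or> coord_less p q \<or> coord_less q p"
    proof (intro ballI)
      fix p q assume "p \<in> S" "q \<in> S"
      then have "coord_le (?c p) (?c q) \<or> coord_le (?c q) (?c p)"
        by (intro near_level_comparable[of m]) (simp_all add: S_def)
      then show "p = q \<or> coord_less p q \<or> coord_less q p"
        unfolding coord_less_def using coord_le_refl linorder_less_linear[of p q] by metis
    qed
    show "coord_less p x" if "coord_less p q" "coord_less q x" for p q x
      using that by (rule coord_less_trans)
    show "\<not> coord_less p p" for p by (simp add: coord_less_def)
  qed fact
  then obtain p q where pq: "p < n" "q < n" "(?N ^\<^sub>m (level_bound ks m - 1)) $$ (p, q) > 0"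
    unfolding card by (auto simp: S_def)
  interpret of_nat_hom: semiring_hom "of_nat :: nat \<Rightarrow> 'b"
    by unfold_locales simp_all
  have "(path_mat :: 'b mat) = map_mat of_nat ?N"
    by (rule eq_matI) (auto simp: path_mat_def)
  then have "(path_mat :: 'b mat) ^\<^sub>m (level_bound ks m - 1)
      = map_mat of_nat (?N ^\<^sub>m (level_bound ks m - 1))"
    by (simp only: of_nat_hom.mat_hom_pow[OF path_mat_carrier])
  then have "((path_mat :: 'b mat) ^\<^sub>m (level_bound ks m - 1)) $$ (p, q)
      = of_nat ((?N ^\<^sub>m (level_bound ks m - 1)) $$ (p, q))"
    using pq carrier_matD[OF path_mat_carrier[where 'b = nat]] by simp
  also have "\<dots> \<noteq> 0" using pq(3) by simp
  finally show ?thesis using pq(1,2) by auto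
qed

end

section \<open>The two maxima compared in a Jordan basis\<close>

theorem theorem16:
  fixes B :: "'a::field_char_0 mat" and n :: nat and \<mu> :: "nat list"
  assumes "n \<ge> 1"
    and "B \<in> carrier_mat n n"
    and "nilpotent_mat B"
    and "shape B = \<mu>"
  shows "Max (nilpotency_index ` nilpotent_commutator B) =
    Max {2 * i + (\<Sum>j = i + 1..i + r. part \<mu> j) | i r.
      i < length \<mu> \<and> 1 \<le> r \<and> i + r \<le> length \<mu> \<and>
      int (part \<mu> (i + 1)) - int (part \<mu> (i + r)) \<le> 1 \<and>
      part \<mu> i \<noteq> part \<mu> (i + 1)}"
proof -
  note B = assms(2)
  obtain k where "B ^\<^sub>m k = 0\<^sub>m n n" using assms(2,3) by (auto simp: nilpotent_mat_def)
  then obtain ks where nf: "jordan_nf B (map (\<lambda>k. (k, 0)) ks)"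
    using nilpotent_jordan_nf_zero[OF B] by blast
  define J where "J = (jordan_matrix (map (\<lambda>k. (k, 0)) ks) :: 'a mat)"
  obtain P Q where wit: "similar_mat_wit B J P Q"
    using nf unfolding jordan_nf_def similar_mat_def J_def by blast
  note D = similar_mat_witD2[OF B wit]
  have n: "n = sum_list ks"
    using jordan_carrier[of ks, where 'a = 'a] D(5) unfolding J_def by auto
  have pos: "0 < m" if "m \<in> set ks" for m
    using nf that by (force simp: jordan_nf_def)
  have "ks \<noteq> []" using n assms(1) by auto
  have \<mu>: "\<mu> = rev (sort ks)" using shape_eq[OF nf] assms(4) by (simp add: comp_def)
  \<comment> \<open>The common value of both sides.\<close>
  define L where "L = Max (level_bound ks ` set ks)"
  have lb: "level_bound ks m \<le> L" if "m \<in> set ks" for m using that by (simp add: L_def)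
  \<comment> \<open>The blocks of the Jordan form come in any order, and \<open>level_bound\<close>
    depends only on their multiset.\<close>
  have "level_bound \<mu> m = level_bound ks m" for m
    by (rule level_bound_mset) (simp add: \<mu>)
  moreover have "set \<mu> = set ks" by (simp add: \<mu>)
  then have "\<mu> \<noteq> []" using \<open>ks \<noteq> []\<close> by auto
  moreover have "sorted_wrt (\<ge>) \<mu>" unfolding \<mu> by (simp add: sorted_wrt_rev)
  ultimately have rhs: "Max {2 * i + (\<Sum>j = i + 1..i + r. part \<mu> j) | i r.
      i < length \<mu> \<and> 1 \<le> r \<and> i + r \<le> length \<mu> \<and>
      int (part \<mu> (i + 1)) - int (part \<mu> (i + r)) \<le> 1 \<and>
      part \<mu> i \<noteq> part \<mu> (i + 1)} = L"
    using \<open>\<mu> \<noteq> []\<close> by (subst Max_path_lengths) (simp_all add: L_def \<open>set \<mu> = set ks\<close>)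
  have "L \<in> level_bound ks ` set ks" unfolding L_def using \<open>ks \<noteq> []\<close> by (intro Max_in) auto
  then obtain m where m: "m \<in> set ks" "level_bound ks m = L" by blast
  have "0 < L" using le_level_bound[OF m(1)] pos[OF m(1)] m(2) by simp
  have J: "J = Q * B * P"
    using similar_mat_witD2(3)[OF D(5) similar_mat_wit_sym[OF wit]] .
  have upper: "nilpotency_index A \<le> L" if "A \<in> nilpotent_commutator B" for A
  proof -
    have A: "A \<in> carrier_mat n n" "A * B = B * A" and "nilpotent_mat A"
      using that B by (auto simp: nilpotent_commutator_def)
    then obtain k where "A ^\<^sub>m k = 0\<^sub>m n n" by (auto simp: nilpotent_mat_def)
    \<comment> \<open>Conjugation carries \<open>B\<close> to \<open>J\<close> and \<open>A\<close>
      to a matrix commuting with \<open>J\<close>, whose support is then known.\<close>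
    define A' where "A' = Q * A * P"
    have A': "A' \<in> carrier_mat n n" unfolding A'_def using D A by auto
    have comm: "A' * J = J * A'"
      unfolding A'_def J
      using mat_conj_mult[OF D(7,6,1) A(1) B] mat_conj_mult[OF D(7,6,1) B A(1)] A(2) by simp
    have wit': "similar_mat_wit A A' P Q" unfolding A'_def
      by (rule similar_mat_wit_conj[OF D(6,7,1,2) A(1)])
    have "A' ^\<^sub>m k = 0\<^sub>m n n"
      using similar_mat_wit_pow_zero_iff[OF wit' A(1)] \<open>A ^\<^sub>m k = 0\<^sub>m n n\<close> by simp
    then have "A' ^\<^sub>m L = 0\<^sub>m n n"
    proof (rule nilpotent_pow_zero_chain_bound[OF A',
          where R = "\<lambda>p q. coord_le (block_coords ks ! p) (block_coords ks ! q)"])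
      show "coord_le (block_coords ks ! p) (block_coords ks ! q)"
        if "p < n" "q < n" "A' $$ (p, q) \<noteq> 0" for p q
        using jordan_commute_support[of A' ks p q] A' comm that unfolding n J_def by blast
      fix S assume S: "S \<subseteq> {..<n}" "\<forall>p\<in>S. \<forall>q\<in>S. coord_le (block_coords ks ! p) (block_coords ks ! q)
        \<or> coord_le (block_coords ks ! q) (block_coords ks ! p)"
      show "card S \<le> L"
        using comparable_card_le_level_bound[OF S(1)[unfolded n] _ S(2)] lb
        by (cases "S = {}") (auto intro: le_trans)
    qed (auto intro: coord_le_refl coord_le_trans)
    then have "A ^\<^sub>m L = 0\<^sub>m n n"
      using similar_mat_wit_pow_zero_iff[OF wit' A(1)] by simp
    then show ?thesis unfolding nilpotency_index_def using A(1) \<open>0 < L\<close> by (intro Least_le) auto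
  qed
  have "L \<in> nilpotency_index ` nilpotent_commutator B"
  proof
    define M where "M = (path_mat ks :: 'a mat)"
    \<comment> \<open>The path matrix, carried back from the Jordan basis.\<close>
    define A where "A = P * M * Q"
    have M: "M \<in> carrier_mat n n" unfolding M_def n by (rule path_mat_carrier)
    have A: "A \<in> carrier_mat n n" unfolding A_def using D M by auto
    have "M * J = J * M" unfolding M_def J_def by (rule path_mat_commute)
    then have comm: "A * B = B * A"
      unfolding A_def D(3)
      using mat_conj_mult[OF D(6,7,2) M D(5)] mat_conj_mult[OF D(6,7,2) D(5) M] by simp
    have wit': "similar_mat_wit A M P Q" unfolding A_def
      by (rule similar_mat_wit_sym[OF similar_mat_wit_conj[OF D(7,6,2,1) M]])
    obtain k where "M ^\<^sub>m k = 0\<^sub>m n n" using path_mat_nilpotent[of ks] unfolding M_def n by blast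
    then have "A ^\<^sub>m k = 0\<^sub>m n n" using similar_mat_wit_pow_zero_iff[OF wit' A] by simp
    then have "nilpotent_mat A" using A by (auto simp: nilpotent_mat_def)
    then show mem: "A \<in> nilpotent_commutator B"
      using A B comm by (auto simp: nilpotent_commutator_def)
    have "M ^\<^sub>m (L - 1) \<noteq> 0\<^sub>m n n"
      using path_mat_pow_nonzero[OF m(1) pos[OF m(1)], where 'b = 'a] unfolding M_def n m(2) .
    then have nz: "A ^\<^sub>m (L - 1) \<noteq> 0\<^sub>m n n" using similar_mat_wit_pow_zero_iff[OF wit' A] by simp
    have "1 \<le> nilpotency_index A \<and> A ^\<^sub>m nilpotency_index A = 0\<^sub>m n n"
    proof -
      have "1 \<le> Suc k \<and> A ^\<^sub>m Suc k = 0\<^sub>m (dim_row A) (dim_row A)"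
        using \<open>A ^\<^sub>m k = 0\<^sub>m n n\<close> A by simp
      from LeastI[of "\<lambda>i. 1 \<le> i \<and> A ^\<^sub>m i = 0\<^sub>m (dim_row A) (dim_row A)", OF this]
      show ?thesis unfolding nilpotency_index_def using A by simp
    qed
    \<comment> \<open>If a power with exponent at most \<open>L - 1\<close> vanished, so would the
      power \<open>L - 1\<close>.\<close>
    then have "\<not> nilpotency_index A \<le> L - 1"
      using nz pow_mat_add[OF A, of "nilpotency_index A" "L - 1 - nilpotency_index A"] A by auto
    then show "L = nilpotency_index A" using upper[OF mem] by simp
  qed
  then have "Max (nilpotency_index ` nilpotent_commutator B) = L"
  proof (rule Max_eqI[rotated 2])
    have "nilpotency_index ` nilpotent_commutator B \<subseteq> {..L}" using upper by blast
    then show "finite (nilpotency_index ` nilpotent_commutator B)" by (rule finite_subset) simp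
  qed (use upper in blast)
  then show ?thesis using rhs by (simp only:)
qed

end
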